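(* Let $c\colon\mathbf{W}\to\mathbf{E}$ be a $C^1$-smooth map between Euclidean spaces and let $h\colon\mathbf{E}\to\mathbb{R}\cup\{\infty\}$ be a closed function. Fix a set $\mathcal{M}\subset\mathrm{dom}\,h$ and a point $\bar x\in\mathbf{W}$ with $c(\bar x)\in\mathcal{M}$. Suppose that $\mathcal{M}$ is a $C^1$ manifold around $c(\bar x)$, the restriction $h|_{\mathcal{M}}$ is $C^1$-smooth near $c(\bar x)$, and transversality holds: $$N_{\mathcal{M}}(c(\bar x))\cap\mathrm{Null}(\nabla c(\bar x)^* )=\{0\}.$$ Define the composition $f(x)=h(c(x))$ and the set $\mathcal{L}:=c^{-1}(\mathcal{M})$. Let $\diamond\in\{\le,=,\ge\}$. The following are true. 1. If $h$ is $(a)$-regular along $\mathcal{M}$ near $c(\bar x)$, then $f$ is $(a)$-regular along $\mathcal{L}$ near $\bar x$. 2. If $h$ is $(a)$-regular and $(b_\diamond)$-regular along $\mathcal{M}$ near $c(\bar x)$, then $f$ is $(b_\diamond)$-regular along $\mathcal{L}$ near $\bar x$. If in addition $c$ is $C^2$-smooth, $\mathcal{M}$ is a $C^2$ manifold around $c(\bar x)$ and the restriction $h|_{\mathcal{M}}$ is $C^2$-smooth near $c(\bar x)$, then the following are true. 3. If $h$ is strongly $(a)$-regular along $\mathcal{M}$ near $c(\bar x)$, then $f$ is strongly $(a)$-regular along $\mathcal{L}$ near $\bar x$. 4. If $h$ is both $(a)$-regular and strongly $(b_\diamond)$-regular along $\mathcal{M}$ near $c(\bar x)$, then $f$ is strongly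 $(b_\diamond)$-regular along $\mathcal{L}$ near $\bar x$.
   Context: A function is closed if its epigraph is closed. $\mathbf{B}$ is the closed unit ball. The Fréchet normal cone $\hat N_Q(x)$ to $Q$ at $x\in Q$ is the set of $v$ with $\langle v,y-x\rangle\le o(\|y-x\|)$ as $y\to x$ in $Q$; the limiting normal cone $N_Q(x)$ consists of limits of $v_i\in\hat N_Q(x_i)$ with $x_i\to x$ in $Q$ (for a manifold this is the normal space). $\Delta(U,V)=\sup\{\mathrm{dist}(u,V):u\in U,\|u\|=1\}$ for closed cones $U,V$. Regularity of a set $\mathcal{X}$ along a set $\mathcal{Y}$: (a): for any $x_i\in\mathcal{X}$ converging to $y\in\mathcal{Y}$ and $v_i\in N_{\mathcal{X}}(x_i)$, every limit point of $v_i$ lies in $N_{\mathcal{Y}}(y)$. $(b_\le)$, $(b_\ge)$, $(b_=)$: for all $x\in\mathcal{X}$, $y\in\mathcal{Y}$, $v\in N_{\mathcal{X}}(x)\cap\mathbf{B}$ one has, respectively, $\langle v,y-x\rangle\le o(\|y-x\|)$, $\ge o(\|y-x\|)$, $=o(\|y-x\|)$, where $o(\cdot)$ is a univariate error with $o(t)/t\to0$ as $t\searrow0$. strong (a): there is $C>0$ with $\Delta(N_{\mathcal{X}}(x),N_{\mathcal{Y}}(y))\le C\|x-y\|$ for all $x\in\mathcal{X}$, $y\in\mathcal{Y}$. strong $(b_\le)$, $(b_\ge)$, $(b_=)$: there is $C>0$ such that for all such $x,y,v$ one has, respectively, $\langle v,y-x\rangle\le C\|x-y\|^2$, $\langle v,y-x\rangle\ge-C\|x-y\|^2$,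 $|\langle v,y-x\rangle|\le C\|x-y\|^2$. Each property holds near $\bar z\in\mathcal{Y}$ if it holds for $\mathcal{X}\cap U$ along $\mathcal{Y}\cap U$ for some neighborhood $U$ of $\bar z$. A function $f$ has one of these properties along $\mathcal{M}\subseteq\mathrm{dom} f$ near $\bar x\in\mathcal{M}$ if $\mathrm{epi} f$ has it along $\mathrm{gph} f|_{\mathcal{M}}=\{(x,f(x)):x\in\mathcal{M}\}$ near $(\bar x,f(\bar x))$. *)

theory Defs
  imports "HOL-Analysis.Analysis"
begin

definition C1_map_on :: "('a::real_normed_vector \<Rightarrow> 'b::real_normed_vector) \<Rightarrow> 'a set \<Rightarrow> bool" where
  "C1_map_on f U \<longleftrightarrow>
     (\<exists>f' :: 'a \<Rightarrow> 'a \<Rightarrow>\<^sub>L 'b.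
        (\<forall>x\<in>U. (f has_derivative blinfun_apply (f' x)) (at x)) \<and> continuous_on U f')"

definition C2_map_on :: "('a::real_normed_vector \<Rightarrow> 'b::real_normed_vector) \<Rightarrow> 'a set \<Rightarrow> bool" where
  "C2_map_on f U \<longleftrightarrow>
     (\<exists>f' :: 'a \<Rightarrow> 'a \<Rightarrow>\<^sub>L 'b.
        (\<forall>x\<in>U. (f has_derivative blinfun_apply (f' x)) (at x)) \<and> C1_map_on f' U)"

(* Near x, M is the zero set of a smooth map F with surjective derivative at x.  The codomain
   of F is a linear subspace T of the ambient space: a Euclidean space onto which the ambient
   space maps linearly has no larger dimension, so every codimension (including 0) is covered.
   The order of smoothness enters through the predicate S, one of C1_map_on and C2_map_on. *)
definition manifold_around ::
    "(('a::euclidean_space \<Rightarrow> 'a) \<Rightarrow> 'a set \<Rightarrow> bool) \<Rightarrow> 'a set \<Rightarrow> 'a \<Rightarrow> bool" where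
  "manifold_around S M x \<longleftrightarrow> x \<in> M \<and>
     (\<exists>U T F. open U \<and> x \<in> U \<and> subspace T \<and> F ` U \<subseteq> T \<and> S F U \<and>
        range (frechet_derivative F (at x)) = T \<and> M \<inter> U = {y \<in> U. F y = 0})"

(* A function on M is smooth near x if it agrees on M, near x, with a smooth function
   defined on an open neighbourhood of x. *)
definition restriction_smooth_near ::
    "(('a::euclidean_space \<Rightarrow> real) \<Rightarrow> 'a set \<Rightarrow> bool) \<Rightarrow> ('a \<Rightarrow> ereal) \<Rightarrow> 'a set \<Rightarrow> 'a \<Rightarrow> bool" where
  "restriction_smooth_near S h M x \<longleftrightarrow>
     (\<exists>U g. open U \<and> x \<in> U \<and> S g U \<and> (\<forall>y\<in>M \<inter> U. h y = ereal (g y)))"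

definition epi :: "('a \<Rightarrow> ereal) \<Rightarrow> ('a \<times> real) set" where
  "epi f = {(x, r). f x \<le> ereal r}"

definition gph_on :: "('a \<Rightarrow> ereal) \<Rightarrow> 'a set \<Rightarrow> ('a \<times> real) set" where
  "gph_on f M = {(x, r). x \<in> M \<and> f x = ereal r}"

definition eff_dom :: "('a \<Rightarrow> ereal) \<Rightarrow> 'a set" where
  "eff_dom f = {x. f x < \<infinity>}"

(* Both cones are empty at points outside Q. *)
definition frechet_normal_cone :: "'a::euclidean_space set \<Rightarrow> 'a \<Rightarrow> 'a set" where
  "frechet_normal_cone Q x =
     {v. x \<in> Q \<and>
         (\<forall>\<epsilon>>0. eventually (\<lambda>y. v \<bullet> (y - x) \<le> \<epsilon> * norm (y - x)) (at x within Q))}"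

definition normal_cone :: "'a::euclidean_space set \<Rightarrow> 'a \<Rightarrow> 'a set" where
  "normal_cone Q x =
     {v. x \<in> Q \<and>
         (\<exists>xs vs. (\<forall>i::nat. vs i \<in> frechet_normal_cone Q (xs i)) \<and>
            xs \<longlonglongrightarrow> x \<and> vs \<longlonglongrightarrow> v)}"

(* In ennreal the supremum of the empty set (the case U = {0}) is 0. *)
definition cone_gap :: "'a::euclidean_space set \<Rightarrow> 'a set \<Rightarrow> ennreal" where
  "cone_gap U V = (SUP u\<in>{u\<in>U. norm u = 1}. ennreal (infdist u V))"

(* A limit point of a sequence is the limit of one of its subsequences. *)
definition a_regular :: "'a::euclidean_space set \<Rightarrow> 'a set \<Rightarrow> bool" where
  "a_regular X Y \<longleftrightarrow>
     (\<forall>xs vs y w \<phi>.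
        (\<forall>i::nat. xs i \<in> X) \<and> y \<in> Y \<and> xs \<longlonglongrightarrow> y \<and>
        (\<forall>i. vs i \<in> normal_cone X (xs i)) \<and>
        strict_mono \<phi> \<and> (vs \<circ> \<phi>) \<longlonglongrightarrow> w \<longrightarrow> w \<in> normal_cone Y y)"

definition strongly_a_regular :: "'a::euclidean_space set \<Rightarrow> 'a set \<Rightarrow> bool" where
  "strongly_a_regular X Y \<longleftrightarrow>
     (\<exists>C>0. \<forall>x\<in>X. \<forall>y\<in>Y.
        cone_gap (normal_cone X x) (normal_cone Y y) \<le> ennreal (C * norm (x - y)))"

datatype rel_sign = LE | EQ | GE

(* rel_bound d s t:  s \<le> t,  \<bar>s\<bar> \<le> t,  s \<ge> - t  respectively. *)
fun rel_bound :: "rel_sign \<Rightarrow> real \<Rightarrow> real \<Rightarrow> bool" where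
  "rel_bound LE s t \<longleftrightarrow> s \<le> t"
| "rel_bound EQ s t \<longleftrightarrow> \<bar>s\<bar> \<le> t"
| "rel_bound GE s t \<longleftrightarrow> s \<ge> - t"

(* For GE the bound s \<ge> - t is the usual s \<ge> o(.), since the error functions are closed
   under negation; for EQ, s = o(.) means that the absolute value of s is bounded by the error. *)
definition b_regular :: "rel_sign \<Rightarrow> 'a::euclidean_space set \<Rightarrow> 'a set \<Rightarrow> bool" where
  "b_regular d X Y \<longleftrightarrow>
     (\<exists>\<omega> :: real \<Rightarrow> real. ((\<lambda>t. \<omega> t / t) \<longlongrightarrow> 0) (at_right 0) \<and>
        (\<forall>x\<in>X. \<forall>y\<in>Y. \<forall>v \<in> normal_cone X x \<inter> cball 0 1.
           rel_bound d (v \<bullet> (y - x)) (\<omega> (norm (y - x)))))"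

definition strongly_b_regular :: "rel_sign \<Rightarrow> 'a::euclidean_space set \<Rightarrow> 'a set \<Rightarrow> bool" where
  "strongly_b_regular d X Y \<longleftrightarrow>
     (\<exists>C>0. \<forall>x\<in>X. \<forall>y\<in>Y. \<forall>v \<in> normal_cone X x \<inter> cball 0 1.
        rel_bound d (v \<bullet> (y - x)) (C * (norm (x - y))\<^sup>2))"

definition reg_near ::
    "('a::euclidean_space set \<Rightarrow> 'a set \<Rightarrow> bool) \<Rightarrow> 'a set \<Rightarrow> 'a set \<Rightarrow> 'a \<Rightarrow> bool" where
  "reg_near P X Y z \<longleftrightarrow> z \<in> Y \<and> (\<exists>U. open U \<and> z \<in> U \<and> P (X \<inter> U) (Y \<inter> U))"

definition fun_reg_near ::
    "(('a::euclidean_space \<times> real) set \<Rightarrow> ('a \<times> real) set \<Rightarrow> bool) \<Rightarrow>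
     ('a \<Rightarrow> ereal) \<Rightarrow> 'a set \<Rightarrow> 'a \<Rightarrow> bool" where
  "fun_reg_near P f M x \<longleftrightarrow> M \<subseteq> eff_dom f \<and> x \<in> M \<and>
     reg_near P (epi f) (gph_on f M) (x, real_of_ereal (f x))"

end

theory Submission
  imports Defs
begin

text \<open>With \<open>\<Phi> (x, r) = (c x, r)\<close> the epigraph of \<open>f\<close> and the graph of its restriction to \<open>L\<close> are the preimages
  under \<open>\<Phi>\<close> of the corresponding sets \<open>X\<close>, \<open>Y\<close> for \<open>h\<close>. By \<open>(a)\<close>-regularity, transversality at the base
  point propagates to a uniform lower bound \<open>\<kappa> * norm w \<le> norm (\<Phi>'(x)* w)\<close> for normals \<open>w\<close> to \<open>X\<close> nearby, which
  is a constraint qualification: every normal to the preimage of \<open>X\<close> is \<open>\<Phi>'(x)* w\<close> with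
  \<open>w\<close> normal to \<open>X\<close> and bounded by it. Conversely, since limiting and Frechet normals of the manifold \<open>Y\<close> agree,
  \<open>\<Phi>'(x)*\<close> maps normals of \<open>Y\<close> to normals of its preimage. All properties are then transported by
  replacing \<open>\<Phi>'(x) (y - x)\<close> with \<open>\<Phi> y - \<Phi> x\<close>, at the cost of a first-order, or for \<open>C\<^sup>2\<close> data
  second-order, Taylor remainder.\<close>

text \<open>The obstacle is that \<open>X\<close> is an arbitrary closed set. Penalization yields a
  normal at a point \<open>u\<close> of \<open>X\<close> and a derivative at a point
  \<open>y\<close> that need not satisfy \<open>u = \<Phi> y\<close>, so the lower bound must hold
  for \<open>y\<close> and \<open>u\<close> varying independently near the base point. The constant
  \<open>\<kappa>\<close> does two jobs: it keeps the multipliers \<open>w\<close> bounded when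
  limits are taken, and it puts \<open>\<kappa> *\<^sub>R w\<close> into the unit ball, where the
  (b) conditions speak. Closedness of the epigraph enters through the existence of the penalty
  minimizers. Only one inclusion is used on each side: normals to the preimage of \<open>X\<close>
  are pullbacks, and pullbacks of normals to \<open>Y\<close> are normal to its preimage. Carrying
  the coordinate \<open>r\<close> along keeps transversality: a vector annihilated by the adjoint
  derivative of \<open>\<Phi>\<close> has no vertical part, and a graph normal without vertical part
  is a normal of the manifold. The lower bound is the reason why (a) accompanies the (b) conditions;
  strong (a) supplies (a) by itself.\<close>

section \<open>Frechet and limiting normal cones: locality, closedness, scaling\<close>

lemma frechet_normal_cone_Int_open:
  assumes "open U" "x \<in> U"
  shows "frechet_normal_cone (Q \<inter> U) x = frechet_normal_cone Q x"
proof -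
  have "at x within Q \<inter> U = at x within Q"
    by (rule at_within_nhd[OF assms(2,1)]) auto
  then show ?thesis
    using assms(2) by (simp add: frechet_normal_cone_def)
qed

lemma frechet_normal_coneD:
  assumes "v \<in> frechet_normal_cone Q x" "\<epsilon> > 0"
  shows "\<forall>\<^sub>F y in at x within Q. v \<bullet> (y - x) \<le> \<epsilon> * norm (y - x)"
  using assms by (simp add: frechet_normal_cone_def)

text \<open>Does the extraction of sequences once, so that approximations of approximations later
  reduce to the triangle inequality.\<close>

lemma normal_cone_iff:
  "v \<in> normal_cone Q x \<longleftrightarrow> x \<in> Q \<and>
     (\<forall>\<epsilon>>0. \<exists>x' v'. v' \<in> frechet_normal_cone Q x' \<and> dist x' x < \<epsilon> \<and> dist v' v < \<epsilon>)"
proof safe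
  assume v: "v \<in> normal_cone Q x"
  then show "x \<in> Q" by (simp add: normal_cone_def)
  fix \<epsilon> :: real assume "\<epsilon> > 0"
  obtain xs vs where *: "\<And>i::nat. vs i \<in> frechet_normal_cone Q (xs i)" "xs \<longlonglongrightarrow> x" "vs \<longlonglongrightarrow> v"
    using v by (auto simp: normal_cone_def)
  have "\<forall>\<^sub>F i in sequentially. dist (xs i) x < \<epsilon> \<and> dist (vs i) v < \<epsilon>"
    using *(2,3) \<open>\<epsilon> > 0\<close> by (auto intro!: eventually_conj simp: tendsto_iff)
  then show "\<exists>x' v'. v' \<in> frechet_normal_cone Q x' \<and> dist x' x < \<epsilon> \<and> dist v' v < \<epsilon>"
    using *(1) eventually_happens'[OF sequentially_bot] by blast
next
  assume x: "x \<in> Q" and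
    *: "\<forall>\<epsilon>>0. \<exists>x' v'. v' \<in> frechet_normal_cone Q x' \<and> dist x' x < \<epsilon> \<and> dist v' v < \<epsilon>"
  have "\<forall>n::nat. \<exists>x' v'. v' \<in> frechet_normal_cone Q x' \<and>
      dist x' x < inverse (real (Suc n)) \<and> dist v' v < inverse (real (Suc n))"
    using * by (meson inverse_positive_iff_positive of_nat_0_less_iff zero_less_Suc)
  then obtain xs vs where **: "\<And>n::nat. vs n \<in> frechet_normal_cone Q (xs n)"
      "\<And>n. dist (xs n) x < inverse (real (Suc n))" "\<And>n. dist (vs n) v < inverse (real (Suc n))"
    by metis
  have "xs \<longlonglongrightarrow> x" "vs \<longlonglongrightarrow> v"
    by (rule metric_tendsto_imp_tendsto[OF LIMSEQ_inverse_real_of_nat];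
        use **(2,3)[THEN less_imp_le] in \<open>simp add: dist_real_def\<close>)+
  then show "v \<in> normal_cone Q x"
    using x **(1) by (auto simp: normal_cone_def)
qed

lemma frechet_subset_normal_cone: "frechet_normal_cone Q x \<subseteq> normal_cone Q x"
proof
  fix v assume v: "v \<in> frechet_normal_cone Q x"
  then have "x \<in> Q" by (simp add: frechet_normal_cone_def)
  with v show "v \<in> normal_cone Q x"
    unfolding normal_cone_iff by (metis dist_self)
qed

lemma normal_cone_Int_open:
  assumes "open U" "x \<in> U"
  shows "normal_cone (Q \<inter> U) x = normal_cone Q x"
proof (intro set_eqI iffI)
  fix v assume v: "v \<in> normal_cone (Q \<inter> U) x"
  have "v' \<in> frechet_normal_cone (Q \<inter> U) x' \<Longrightarrow> v' \<in> frechet_normal_cone Q x'" for v' x'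
    using frechet_normal_cone_Int_open[OF assms(1), of x' Q]
    by (auto simp: frechet_normal_cone_def)
  then show "v \<in> normal_cone Q x"
    using v unfolding normal_cone_def by blast
next
  fix v assume v: "v \<in> normal_cone Q x"
  obtain r where r: "r > 0" "ball x r \<subseteq> U"
    using assms open_contains_ball by blast
  show "v \<in> normal_cone (Q \<inter> U) x"
    unfolding normal_cone_iff
  proof (intro conjI allI impI)
    show "x \<in> Q \<inter> U" using v assms by (auto simp: normal_cone_def)
    fix \<epsilon> :: real assume "\<epsilon> > 0"
    \<comment> \<open>The radius \<open>r\<close> confines \<open>x'\<close> to \<open>U\<close>,
      where the two Frechet cones agree.\<close>
    then obtain x' v' where "v' \<in> frechet_normal_cone Q x'" "dist x' x < min \<epsilon> r" "dist v' v < min \<epsilon> r"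
      using v r unfolding normal_cone_iff by (metis min_less_iff_conj)
    moreover from this have "x' \<in> U" using r by (auto simp: subset_iff dist_commute)
    ultimately show "\<exists>x' v'. v' \<in> frechet_normal_cone (Q \<inter> U) x' \<and> dist x' x < \<epsilon> \<and> dist v' v < \<epsilon>"
      using frechet_normal_cone_Int_open[OF assms(1)] by (metis min_less_iff_conj)
  qed
qed

text \<open>Each \<open>ws i\<close> is replaced by a nearby Frechet normal, with half of
  \<open>\<epsilon>\<close> spent on each of the two approximations. Membership is asked for only
  eventually because sequences enter a given neighbourhood only from some index on.\<close>

lemma normal_cone_closed_graph:
  assumes "x \<in> Q" "xs \<longlonglongrightarrow> x" "ws \<longlonglongrightarrow> w"
    and "\<forall>\<^sub>F i in sequentially. ws i \<in> normal_cone Q (xs i)"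
  shows "w \<in> normal_cone Q x"
  unfolding normal_cone_iff
proof (intro conjI allI impI)
  fix \<epsilon> :: real assume "\<epsilon> > 0"
  have "\<forall>\<^sub>F i in sequentially. dist (xs i) x < \<epsilon>/2 \<and> dist (ws i) w < \<epsilon>/2 \<and> ws i \<in> normal_cone Q (xs i)"
    using assms(2-4) half_gt_zero[OF \<open>\<epsilon> > 0\<close>] unfolding tendsto_iff by (intro eventually_conj) blast+
  then obtain i where i: "dist (xs i) x < \<epsilon>/2" "dist (ws i) w < \<epsilon>/2" "ws i \<in> normal_cone Q (xs i)"
    using eventually_happens'[OF sequentially_bot] by blast
  obtain x' v' where "v' \<in> frechet_normal_cone Q x'" "dist x' (xs i) < \<epsilon>/2" "dist v' (ws i) < \<epsilon>/2"
    using i(3) \<open>\<epsilon> > 0\<close> unfolding normal_cone_iff by (meson half_gt_zero)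
  then show "\<exists>x' v'. v' \<in> frechet_normal_cone Q x' \<and> dist x' x < \<epsilon> \<and> dist v' w < \<epsilon>"
    using i(1,2) dist_triangle[of x' x "xs i"] dist_triangle[of v' w "ws i"]
    by (intro exI[of _ x'] exI[of _ v']) simp
qed (use assms in auto)

lemma closed_normal_cone: "closed (normal_cone Q x)"
  unfolding closed_sequential_limits
proof safe
  fix ws w assume *: "\<forall>n. ws n \<in> normal_cone Q x" "ws \<longlonglongrightarrow> w"
  then have "x \<in> Q" by (auto simp: normal_cone_def)
  then show "w \<in> normal_cone Q x"
    by (rule normal_cone_closed_graph[of _ _ "\<lambda>_. x" ws]) (use * in auto)
qed

lemma frechet_normal_cone_scale:
  assumes "v \<in> frechet_normal_cone Q x" "c > 0"
  shows "c *\<^sub>R v \<in> frechet_normal_cone Q x"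
proof -
  have "\<forall>\<^sub>F y in at x within Q. (c *\<^sub>R v) \<bullet> (y - x) \<le> \<epsilon> * norm (y - x)" if "\<epsilon> > 0" for \<epsilon>
  proof -
    have "\<forall>\<^sub>F y in at x within Q. v \<bullet> (y - x) \<le> (\<epsilon> / c) * norm (y - x)"
      using frechet_normal_coneD[OF assms(1)] divide_pos_pos[OF that assms(2)] .
    then show ?thesis
      by (rule eventually_mono) (use assms(2) in \<open>simp add: field_simps\<close>)
  qed
  then show ?thesis
    using assms by (auto simp: frechet_normal_cone_def)
qed

text \<open>Convexity is special to the Frechet cone; limiting cones can fail it. It allows a graph
  normal to be assembled from two simpler ones.\<close>

lemma frechet_normal_cone_add:
  assumes "v \<in> frechet_normal_cone Q x" "w \<in> frechet_normal_cone Q x"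
  shows "v + w \<in> frechet_normal_cone Q x"
proof -
  have "\<forall>\<^sub>F y in at x within Q. (v + w) \<bullet> (y - x) \<le> \<epsilon> * norm (y - x)" if "\<epsilon> > 0" for \<epsilon>
  proof -
    have "\<forall>\<^sub>F y in at x within Q. v \<bullet> (y - x) \<le> (\<epsilon> / 2) * norm (y - x)"
         "\<forall>\<^sub>F y in at x within Q. w \<bullet> (y - x) \<le> (\<epsilon> / 2) * norm (y - x)"
      using frechet_normal_coneD[OF _ half_gt_zero[OF that]] assms by auto
    then show ?thesis
      by eventually_elim (simp add: inner_add_left)
  qed
  then show ?thesis
    using assms by (auto simp: frechet_normal_cone_def)
qed

lemma zero_in_normal_cone: "x \<in> Q \<Longrightarrow> 0 \<in> normal_cone Q x"
  by (rule subsetD[OF frechet_subset_normal_cone])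
     (auto simp: frechet_normal_cone_def)

lemma normal_cone_scale:
  assumes "v \<in> normal_cone Q x" "c \<ge> 0"
  shows "c *\<^sub>R v \<in> normal_cone Q x"
proof (cases "c = 0")
  case True
  then show ?thesis using assms zero_in_normal_cone by (auto simp: normal_cone_def)
next
  case False
  obtain xs vs where *: "\<And>i::nat. vs i \<in> frechet_normal_cone Q (xs i)" "xs \<longlonglongrightarrow> x" "vs \<longlonglongrightarrow> v" "x \<in> Q"
    using assms by (auto simp: normal_cone_def)
  have "(\<lambda>i. c *\<^sub>R vs i) \<longlonglongrightarrow> c *\<^sub>R v"
    using * by (intro tendsto_intros)
  with * frechet_normal_cone_scale[of _ Q _ c] False assms(2) show ?thesis
    unfolding normal_cone_def by (intro CollectI conjI exI[of _ xs] exI[of _ "\<lambda>i. c *\<^sub>R vs i"]) auto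
qed

section \<open>Adjoints of derivatives and pullback of Frechet normals\<close>

lemma norm_adjoint_blinfun_le:
  fixes A :: "'a::euclidean_space \<Rightarrow>\<^sub>L 'b::euclidean_space"
  shows "norm (adjoint (blinfun_apply A) w) \<le> norm A * norm w"
proof -
  let ?a = "adjoint (blinfun_apply A) w"
  have "norm ?a * norm ?a = ?a \<bullet> adjoint (blinfun_apply A) w"
    by (metis dot_square_norm power2_eq_square)
  also have "\<dots> = blinfun_apply A ?a \<bullet> w"
    by (rule adjoint_works) (intro bounded_linear.linear blinfun.bounded_linear_right)
  also have "\<dots> \<le> norm A * norm ?a * norm w"
    by (meson norm_blinfun norm_cauchy_schwarz norm_ge_zero mult_right_mono order_trans)
  finally show ?thesis
    by (cases "?a = 0") (auto simp: mult_ac)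
qed

lemma inner_adjoint_blinfun:
  fixes A :: "'a::euclidean_space \<Rightarrow>\<^sub>L 'b::euclidean_space"
  shows "adjoint (blinfun_apply A) w \<bullet> d = w \<bullet> blinfun_apply A d"
  using adjoint_works[OF bounded_linear.linear[OF blinfun.bounded_linear_right[of A]], of d w] by (simp add: inner_commute)

lemma adjoint_blinfun_diff:
  fixes A B :: "'a::euclidean_space \<Rightarrow>\<^sub>L 'b::euclidean_space"
  shows "adjoint (blinfun_apply A) w - adjoint (blinfun_apply B) w = adjoint (blinfun_apply (A - B)) w"
  by (rule vector_eq_rdot[THEN iffD1])
     (simp add: inner_adjoint_blinfun inner_diff_left blinfun.diff_left inner_diff_right)

lemma linear_adjoint_blinfun:
  fixes A :: "'a::euclidean_space \<Rightarrow>\<^sub>L 'b::euclidean_space"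
  shows "linear (adjoint (blinfun_apply A))"
  by (rule adjoint_linear) (intro bounded_linear.linear blinfun.bounded_linear_right)

text \<open>Joint continuity is needed because derivative and multiplier vary together along the
  approximating sequences.\<close>

lemma tendsto_adjoint_blinfun:
  fixes A :: "'a::euclidean_space \<Rightarrow>\<^sub>L 'b::euclidean_space"
  assumes "(As \<longlongrightarrow> A) F" "(ws \<longlongrightarrow> w) F"
  shows "((\<lambda>i. adjoint (blinfun_apply (As i)) (ws i)) \<longlongrightarrow> adjoint (blinfun_apply A) w) F"
proof (rule Lim_transform2)
  show "((\<lambda>i. adjoint (blinfun_apply A) (ws i)) \<longlongrightarrow> adjoint (blinfun_apply A) w) F"
    using linear_adjoint_blinfun assms(2)
    by (metis bounded_linear.tendsto linear_conv_bounded_linear)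
  have "((\<lambda>i. norm (A - As i) * norm (ws i)) \<longlongrightarrow> norm (A - A) * norm w) F"
    by (intro tendsto_intros assms)
  then have "((\<lambda>i. norm (A - As i) * norm (ws i)) \<longlongrightarrow> 0) F"
    by simp
  then show "((\<lambda>i. adjoint (blinfun_apply A) (ws i) - adjoint (blinfun_apply (As i)) (ws i)) \<longlongrightarrow> 0) F"
    unfolding adjoint_blinfun_diff
    by (rule Lim_null_comparison[rotated]) (simp add: norm_adjoint_blinfun_le)
qed

text \<open>The easy half of the chain rule, free of any qualification: compose the normal
  inequality with the linearization. Since \<open>S\<close> only has to be mapped into
  \<open>Y\<close> near \<open>x\<close>, it serves preimages, zero sets, parametrizations and
  projections alike.\<close>

lemma adjoint_in_frechet_normal_cone:
  fixes A :: "'a::euclidean_space \<Rightarrow>\<^sub>L 'b::euclidean_space"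
  assumes \<Phi>: "(\<Phi> has_derivative blinfun_apply A) (at x)"
    and x: "x \<in> S" and w: "w \<in> frechet_normal_cone Y (\<Phi> x)"
    and ev: "\<forall>\<^sub>F y in at x within S. \<Phi> y \<in> Y"
  shows "adjoint (blinfun_apply A) w \<in> frechet_normal_cone S x"
proof -
  have "\<forall>\<^sub>F y in at x within S. adjoint (blinfun_apply A) w \<bullet> (y - x) \<le> \<epsilon> * norm (y - x)"
    if \<epsilon>: "\<epsilon> > 0" for \<epsilon>
  proof -
    \<comment> \<open>Half of \<open>\<epsilon>\<close> pays for the linearization error, amplified
      by \<open>norm w\<close>, and half, through \<open>\<zeta>\<close>, for the normal inequality
      at \<open>\<Phi> x\<close>, amplified by the growth rate \<open>norm A + \<eta>\<close> of
      \<open>\<Phi>\<close>. The \<open>+ 1\<close> covers \<open>w = 0\<close>.\<close>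
    define \<eta> where "\<eta> = \<epsilon> / (2 * (norm w + 1))"
    have "norm w + 1 > 0" by (simp add: add_nonneg_pos)
    then have \<eta>: "\<eta> > 0" "norm w * \<eta> \<le> \<epsilon> / 2"
      using \<epsilon> by (simp_all add: \<eta>_def field_simps)
    define \<zeta> where "\<zeta> = \<epsilon> / (2 * (norm A + \<eta>))"
    have K: "norm A + \<eta> > 0" using \<eta> by (simp add: add_nonneg_pos)
    have \<zeta>: "\<zeta> > 0" "\<zeta> * (norm A + \<eta>) = \<epsilon> / 2"
      using \<epsilon> K by (simp_all add: \<zeta>_def field_simps)
    have d: "\<forall>\<^sub>F y in at x within S. norm (\<Phi> y - \<Phi> x - A (y - x)) \<le> \<eta> * norm (y - x)"
      using has_derivative_at_withinI[OF \<Phi>, of S] \<eta>(1) unfolding has_derivative_within_alt2 by blast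
    \<comment> \<open>The punctured filter omits \<open>u = \<Phi> x\<close>, yet
      \<open>\<Phi> y = \<Phi> x\<close> may happen for \<open>y\<close> different from
      \<open>x\<close>; both sides vanish there.\<close>
    obtain \<delta> where \<delta>: "\<delta> > 0"
      "\<And>u. u \<in> Y \<Longrightarrow> dist u (\<Phi> x) < \<delta> \<Longrightarrow> w \<bullet> (u - \<Phi> x) \<le> \<zeta> * norm (u - \<Phi> x)"
    proof -
      have "\<forall>\<^sub>F u in at (\<Phi> x) within Y. w \<bullet> (u - \<Phi> x) \<le> \<zeta> * norm (u - \<Phi> x)"
        using w \<zeta> by (auto simp: frechet_normal_cone_def)
      then obtain \<delta> where "\<delta> > 0" "\<forall>u\<in>Y. u \<noteq> \<Phi> x \<and> dist u (\<Phi> x) < \<delta> \<longrightarrow> w \<bullet> (u - \<Phi> x) \<le> \<zeta> * norm (u - \<Phi> x)"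
        unfolding eventually_at by blast
      then show ?thesis by (intro that[of \<delta>]) (metis norm_zero inner_zero_right mult_zero_right order_refl right_minus_eq)+
    qed
    have "isCont \<Phi> x" using \<Phi> has_derivative_continuous by blast
    then have "(\<Phi> \<longlongrightarrow> \<Phi> x) (at x within S)"
      using Lim_at_imp_Lim_at_within isContD by blast
    then have "\<forall>\<^sub>F y in at x within S. dist (\<Phi> y) (\<Phi> x) < \<delta>"
      using \<delta>(1) by (simp add: tendsto_iff)
    with d ev show ?thesis
    proof eventually_elim
      case (elim y)
      have "norm (\<Phi> y - \<Phi> x) \<le> norm (A (y - x)) + norm (\<Phi> y - \<Phi> x - A (y - x))"
        using norm_triangle_ineq[of "A (y - x)" "\<Phi> y - \<Phi> x - A (y - x)"] by simp
      also have "\<dots> \<le> (norm A + \<eta>) * norm (y - x)"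
        using elim(1) norm_blinfun[of A "y - x"] by (simp add: algebra_simps)
      finally have 1: "norm (\<Phi> y - \<Phi> x) \<le> (norm A + \<eta>) * norm (y - x)" .
      have "adjoint (blinfun_apply A) w \<bullet> (y - x)
          = w \<bullet> (\<Phi> y - \<Phi> x) + w \<bullet> (- (\<Phi> y - \<Phi> x - A (y - x)))"
        by (simp add: inner_adjoint_blinfun inner_diff_right blinfun.diff_right)
      also have "w \<bullet> (- (\<Phi> y - \<Phi> x - A (y - x))) \<le> norm w * (\<eta> * norm (y - x))"
        by (rule order_trans[OF norm_cauchy_schwarz]) (use elim(1) in \<open>auto simp: norm_minus_commute intro!: mult_left_mono\<close>)
      also have "w \<bullet> (\<Phi> y - \<Phi> x) \<le> \<zeta> * norm (\<Phi> y - \<Phi> x)"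
        using \<delta>(2) elim by blast
      also have "\<dots> \<le> \<zeta> * ((norm A + \<eta>) * norm (y - x))"
        using 1 \<zeta> by (auto intro!: mult_left_mono)
      also have "\<dots> = \<epsilon> / 2 * norm (y - x)"
        unfolding \<zeta>(2)[symmetric] by (simp only: mult.assoc)
      also have "norm w * (\<eta> * norm (y - x)) \<le> \<epsilon> / 2 * norm (y - x)"
        using \<eta>(2) by (metis mult.assoc mult_right_mono norm_ge_zero)
      finally show ?case by (simp add: algebra_simps)
    qed
  qed
  then show ?thesis using x by (simp add: frechet_normal_cone_def)
qed

subsection \<open>Chain rule for limiting normal cones\<close>

text \<open>Testing with a short step in the direction \<open>l\<close> itself. This replaces a
  subdifferential sum rule: it bounds the gradient at a minimizer of a smooth function plus a
  Lipschitz term with constant \<open>c\<close>.\<close>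

lemma norm_le_of_inner_le_near:
  fixes l :: "'a::real_inner"
  assumes c: "c \<ge> 0"
    and ev: "\<And>\<eta>. \<eta> > 0 \<Longrightarrow> \<forall>\<^sub>F y in at x. l \<bullet> (y - x) \<le> (c + \<eta>) * norm (y - x)"
  shows "norm l \<le> c"
proof (cases "l = 0")
  case False
  show ?thesis
  proof (rule field_le_epsilon)
    fix \<eta> :: real assume "\<eta> > 0"
    then obtain d where d: "d > 0"
      "\<And>y. y \<noteq> x \<Longrightarrow> dist y x < d \<Longrightarrow> l \<bullet> (y - x) \<le> (c + \<eta>) * norm (y - x)"
      using ev[OF \<open>\<eta> > 0\<close>] unfolding eventually_at by auto
    define t where "t = d / (2 * norm l)"
    have t: "t > 0" "t * norm l < d"
      using d False by (auto simp: t_def)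
    have "t * (norm l * norm l) \<le> t * ((c + \<eta>) * norm l)"
      using d(2)[of "x + t *\<^sub>R l"] t False
      by (simp add: dist_norm dot_square_norm power2_eq_square mult_ac)
    then show "norm l \<le> c + \<eta>"
      using t False by simp
  qed
qed (use c in simp)

text \<open>Expanding the square, the inner product is dominated by a term quadratic in
  \<open>q - u\<close>, hence of lower order than \<open>norm (q - u)\<close>. The weight
  \<open>k\<close> is that of the penalty and may be zero.\<close>

lemma frechet_normal_of_nearest_point:
  assumes u: "u \<in> Q" and k: "k \<ge> 0" "\<delta> > 0"
    and nearest: "\<And>q. q \<in> Q \<Longrightarrow> dist q u < \<delta> \<Longrightarrow> k * (norm (p - u))\<^sup>2 \<le> k * (norm (p - q))\<^sup>2"
  shows "(2 * k) *\<^sub>R (p - u) \<in> frechet_normal_cone Q u"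
proof -
  have "\<forall>\<^sub>F q in at u within Q. ((2 * k) *\<^sub>R (p - u)) \<bullet> (q - u) \<le> \<epsilon> * norm (q - u)" if "\<epsilon> > 0" for \<epsilon>
  proof -
    \<comment> \<open>Within distance \<open>\<epsilon> / (k + 1)\<close> the quadratic term is at
      most \<open>\<epsilon> * norm (q - u)\<close>; the \<open>+ 1\<close> avoids a division by
      zero.\<close>
    have "((2 * k) *\<^sub>R (p - u)) \<bullet> (q - u) \<le> \<epsilon> * norm (q - u)"
      if q: "q \<in> Q" "dist q u < min \<delta> (\<epsilon> / (k + 1))" for q
    proof -
      have "(norm (p - q))\<^sup>2 = (norm (p - u))\<^sup>2 - 2 * ((p - u) \<bullet> (q - u)) + (norm (q - u))\<^sup>2"
        by (simp add: power2_norm_eq_inner algebra_simps inner_diff_left inner_diff_right inner_commute)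
      then have "k * (norm (p - q))\<^sup>2 = k * (norm (p - u))\<^sup>2 - k * (2 * ((p - u) \<bullet> (q - u))) + k * (norm (q - u))\<^sup>2"
        by (simp only: distrib_left right_diff_distrib)
      then have "k * (2 * ((p - u) \<bullet> (q - u))) \<le> k * (norm (q - u))\<^sup>2"
        using nearest[of q] q by simp
      also have "\<dots> \<le> \<epsilon> * norm (q - u)"
      proof -
        have "k * norm (q - u) \<le> (k + 1) * (\<epsilon> / (k + 1))"
          using q k by (intro mult_mono) (auto simp: dist_norm)
        then have "k * norm (q - u) \<le> \<epsilon>" using k by simp
        then show ?thesis
          using mult_right_mono[of _ _ "norm (q - u)"] by (simp add: power2_eq_square mult.assoc[symmetric])
      qed
      finally show ?thesis by simp
    qed
    moreover have "\<forall>\<^sub>F q in at u within Q. q \<in> Q \<and> dist q u < min \<delta> (\<epsilon> / (k + 1))"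
      unfolding eventually_at
      by (rule exI[of _ "min \<delta> (\<epsilon> / (k + 1))"]) (use k \<open>\<epsilon> > 0\<close> in auto)
    ultimately show ?thesis
      by (auto elim: eventually_mono)
  qed
  then show ?thesis using u by (simp add: frechet_normal_cone_def)
qed

text \<open>Penalize the constraint: minimizers \<open>(y, u)\<close> of
  \<open>- v \<bullet> (y - x) + (\<epsilon> / 2) * norm (y - x) + k * norm (\<Phi> y - u)^2\<close> over \<open>y\<close> near \<open>x\<close>, \<open>u \<in> Q\<close> near \<open>\<Phi> x\<close>
  converge to \<open>(x, \<Phi> x)\<close> as \<open>k \<rightarrow> \<infinity>\<close>. Optimality in \<open>u\<close> makes \<open>w = 2 * k * (\<Phi> y - u)\<close> normal to \<open>Q\<close>,
  and optimality in \<open>y\<close> makes the pullback of \<open>w\<close> close to \<open>v\<close>.\<close>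

lemma fuzzy_chain_rule:
  fixes \<Phi> :: "'a::euclidean_space \<Rightarrow> 'b::euclidean_space" and \<Phi>' :: "'a \<Rightarrow> 'a \<Rightarrow>\<^sub>L 'b"
  assumes U: "open U" "x \<in> U"
    and der: "\<And>y. y \<in> U \<Longrightarrow> (\<Phi> has_derivative blinfun_apply (\<Phi>' y)) (at y)"
    and Q: "closed Q"
    and v: "v \<in> frechet_normal_cone (\<Phi> -` Q \<inter> U) x"
    and \<epsilon>: "\<epsilon> > 0"
  obtains y u w where "y \<in> U" "dist y x < \<epsilon>" "dist u (\<Phi> x) < \<epsilon>" "w \<in> frechet_normal_cone Q u"
    "dist (adjoint (blinfun_apply (\<Phi>' y)) w) v < \<epsilon>"
proof -
  have x: "\<Phi> x \<in> Q" using v by (simp add: frechet_normal_cone_def)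
  \<comment> \<open>The slack \<open>\<epsilon> / 4\<close> lies strictly below the weight
    \<open>\<epsilon> / 2\<close> of the norm term in \<open>\<Psi>\<close>; this gap forces the
    limit of the minimizers to be \<open>x\<close>.\<close>
  have "\<forall>\<^sub>F y in at x within \<Phi> -` Q \<inter> U. v \<bullet> (y - x) \<le> (\<epsilon> / 4) * norm (y - x)"
    by (rule frechet_normal_coneD[OF v]) (use \<epsilon> in simp)
  then obtain d where d: "d > 0"
     "\<And>y. y \<in> U \<Longrightarrow> \<Phi> y \<in> Q \<Longrightarrow> y \<noteq> x \<Longrightarrow> dist y x < d \<Longrightarrow> v \<bullet> (y - x) \<le> (\<epsilon> / 4) * norm (y - x)"
    unfolding eventually_at by auto
  obtain r where r: "r > 0" "cball x r \<subseteq> U"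
    using U open_contains_cball by blast
  define \<delta> where "\<delta> = min (min (d / 2) r) (\<epsilon> / 2)"
  have \<delta>: "\<delta> > 0" "\<delta> < d" "\<delta> \<le> r" "\<delta> < \<epsilon>" using d r \<epsilon> by (auto simp: \<delta>_def)
  have cont: "continuous_on (cball x \<delta>) \<Phi>"
    by (intro continuous_at_imp_continuous_on ballI has_derivative_continuous[OF der])
       (use r \<delta> in auto)
  define K where "K = cball x \<delta> \<times> (Q \<inter> cball (\<Phi> x) \<delta>)"
  define \<Psi> where "\<Psi> k z = - (v \<bullet> (fst z - x)) + (\<epsilon>/2) * norm (fst z - x) + k * (norm (\<Phi> (fst z) - snd z))\<^sup>2"
    for k :: real and z
  have K: "compact K" "(x, \<Phi> x) \<in> K"
    using Q x \<delta> by (auto simp: K_def intro!: compact_Times closed_Int_compact)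
  have cK: "continuous_on K (\<lambda>z. \<Phi> (fst z))"
    by (rule continuous_on_compose2[OF cont]) (auto simp: K_def intro!: continuous_intros)
  have c\<Psi>: "continuous_on K (\<Psi> k)" for k
    unfolding \<Psi>_def by (intro continuous_intros cK)
  have "\<forall>n::nat. \<exists>z\<in>K. \<forall>z'\<in>K. \<Psi> (real n) z \<le> \<Psi> (real n) z'"
    using continuous_attains_inf[OF K(1) _ c\<Psi>] K(2) by blast
  then obtain zs where zs: "\<And>n. zs n \<in> K" "\<And>n z'. z' \<in> K \<Longrightarrow> \<Psi> (real n) (zs n) \<le> \<Psi> (real n) z'"
    by metis
  obtain z \<phi> where z: "z \<in> K" "strict_mono \<phi>" "(zs \<circ> \<phi>) \<longlonglongrightarrow> z"
    using K(1) zs(1) unfolding compact_def by metis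
  \<comment> \<open>Comparison with the feasible point \<open>(x, \<Phi> x)\<close>, where
    \<open>\<Psi>\<close> vanishes for every weight.\<close>
  have le: "- (v \<bullet> (fst (zs n) - x)) + (\<epsilon>/2) * norm (fst (zs n) - x)
      + real n * (norm (\<Phi> (fst (zs n)) - snd (zs n)))\<^sup>2 \<le> 0" for n
    using zs(2)[OF K(2), of n] by (simp add: \<Psi>_def)
  define g where "g z = - (v \<bullet> (fst z - x)) + (\<epsilon>/2) * norm (fst z - x)" for z :: "'a \<times> 'b"
  define q where "q z = (norm (\<Phi> (fst z) - snd z))\<^sup>2" for z
  have lim: "(\<lambda>n. \<Phi> (fst (zs (\<phi> n)))) \<longlonglongrightarrow> \<Phi> (fst z)"
    using continuous_on_tendsto_compose[OF cK z(3) z(1)] zs(1) by simp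
  have zl: "(\<lambda>n. zs (\<phi> n)) \<longlonglongrightarrow> z" using z(3) by (simp add: o_def)
  have gl: "(\<lambda>n. g (zs (\<phi> n))) \<longlonglongrightarrow> g z" "(\<lambda>n. q (zs (\<phi> n))) \<longlonglongrightarrow> q z"
    unfolding g_def q_def by (intro tendsto_intros zl lim)+
  have gq: "g (zs n) + real n * q (zs n) \<le> 0" for n
    using le[of n] by (simp add: g_def q_def)
  have q0: "q z' \<ge> 0" for z' by (simp add: q_def)
  have gz: "g z \<le> 0"
    by (rule LIMSEQ_le_const2[OF gl(1)]) (use gq q0 in \<open>metis add_increasing2 mult_nonneg_nonneg of_nat_0_le_iff order.trans order_refl\<close>)
  \<comment> \<open>A positive limit of \<open>q\<close> would drive the penalty to infinity while
    \<open>g\<close> converges, contradicting \<open>gq\<close>.\<close>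
  have qz: "q z = 0"
  proof (rule ccontr)
    assume "q z \<noteq> 0"
    with q0[of z] have pos: "q z > 0" by simp
    have "filterlim (\<lambda>n. real (\<phi> n)) at_top sequentially"
      by (rule filterlim_compose[OF filterlim_real_sequentially filterlim_subseq[OF z(2)]])
    then have "filterlim (\<lambda>n. q (zs (\<phi> n)) * real (\<phi> n)) at_top sequentially"
      using filterlim_tendsto_pos_mult_at_top[OF gl(2) pos] by blast
    then have "filterlim (\<lambda>n. g (zs (\<phi> n)) + q (zs (\<phi> n)) * real (\<phi> n)) at_top sequentially"
      using filterlim_tendsto_add_at_top[OF gl(1)] by blast
    then have "\<forall>\<^sub>F n in sequentially. g (zs (\<phi> n)) + q (zs (\<phi> n)) * real (\<phi> n) > 0"
      unfolding filterlim_at_top_dense by blast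
    then obtain n where "g (zs (\<phi> n)) + q (zs (\<phi> n)) * real (\<phi> n) > 0"
      using eventually_happens'[OF sequentially_bot] by blast
    then show False using gq[of "\<phi> n"] by (simp add: mult.commute)
  qed
  have "fst z = x"
  proof (rule ccontr)
    assume ne: "fst z \<noteq> x"
    have "\<Phi> (fst z) = snd z" using qz by (simp add: q_def)
    moreover have "snd z \<in> Q" "dist (fst z) x \<le> \<delta>" using z(1) by (auto simp: K_def dist_commute)
    moreover from this have "fst z \<in> U" using r \<delta> by (auto simp: dist_commute subset_iff)
    ultimately have "v \<bullet> (fst z - x) \<le> (\<epsilon> / 4) * norm (fst z - x)"
      using d(2) ne \<delta> by auto
    then have "(\<epsilon> / 4) * norm (fst z - x) \<le> 0"
      using gz by (simp add: g_def algebra_simps)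
    then show False using ne \<epsilon> by (simp add: mult_le_0_iff)
  qed
  moreover have "snd z = \<Phi> (fst z)" using qz by (simp add: q_def)
  ultimately have zx: "z = (x, \<Phi> x)" by (simp add: prod_eq_iff)
  have "(\<lambda>n. fst (zs (\<phi> n))) \<longlonglongrightarrow> x" "(\<lambda>n. snd (zs (\<phi> n))) \<longlonglongrightarrow> \<Phi> x"
    using tendsto_fst[OF zl] tendsto_snd[OF zl] zx by auto
  \<comment> \<open>Strict inequalities put the minimizer in the interior of both balls, so the
    localization is inactive in the optimality conditions.\<close>
  then have "\<forall>\<^sub>F n in sequentially. dist (fst (zs (\<phi> n))) x < \<delta> \<and> dist (snd (zs (\<phi> n))) (\<Phi> x) < \<delta>"
    using \<delta>(1) by (auto intro!: eventually_conj simp: tendsto_iff)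
  then obtain m where m: "dist (fst (zs (\<phi> m))) x < \<delta>" "dist (snd (zs (\<phi> m))) (\<Phi> x) < \<delta>"
    using eventually_happens'[OF sequentially_bot] by blast
  define y u k where "y = fst (zs (\<phi> m))" and "u = snd (zs (\<phi> m))" and "k = real (\<phi> m)"
  define w where "w = (2 * k) *\<^sub>R (\<Phi> y - u)"
  have yu: "dist y x < \<delta>" "dist u (\<Phi> x) < \<delta>" "u \<in> Q"
    using m zs(1)[of "\<phi> m"] by (auto simp: y_def u_def K_def)
  have min: "\<Psi> k (y, u) \<le> \<Psi> k (y', u')"
    if "dist y' x \<le> \<delta>" "dist u' (\<Phi> x) \<le> \<delta>" "u' \<in> Q" for y' u'
    using zs(2)[of "(y', u')" "\<phi> m"] that by (auto simp: K_def y_def u_def k_def dist_commute)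
  have yU: "y \<in> U" using yu r \<delta> by (auto simp: dist_commute subset_iff)
  have "w \<in> frechet_normal_cone Q u"
    unfolding w_def
  proof (rule frechet_normal_of_nearest_point[where \<delta> = "\<delta> - dist u (\<Phi> x)"])
    fix q assume "q \<in> Q" "dist q u < \<delta> - dist u (\<Phi> x)"
    moreover from this have "dist q (\<Phi> x) \<le> \<delta>"
      using dist_triangle[of q "\<Phi> x" u] by linarith
    ultimately show "k * (norm (\<Phi> y - u))\<^sup>2 \<le> k * (norm (\<Phi> y - q))\<^sup>2"
      using min[of y q] yu by (simp add: \<Psi>_def)
  qed (use yu in \<open>auto simp: k_def\<close>)
  moreover have "dist (adjoint (blinfun_apply (\<Phi>' y)) w) v \<le> \<epsilon> / 2"
  proof -
    \<comment> \<open>\<open>\<theta>\<close> is the smooth part of \<open>\<Psi>\<close> in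
      \<open>y\<close>, with gradient \<open>- l\<close>. The remaining term is Lipschitz with
      constant \<open>\<epsilon> / 2\<close>, so minimality bounds \<open>norm l\<close> by that
      constant.\<close>
    define l where "l = v - adjoint (blinfun_apply (\<Phi>' y)) w"
    define \<theta> where "\<theta> y' = - (v \<bullet> (y' - x)) + k * ((\<Phi> y' - u) \<bullet> (\<Phi> y' - u))" for y'
    have "(\<theta> has_derivative (\<lambda>h. - (v \<bullet> h) + k * ((\<Phi> y - u) \<bullet> \<Phi>' y h + \<Phi>' y h \<bullet> (\<Phi> y - u)))) (at y)"
      unfolding \<theta>_def by (auto intro!: derivative_eq_intros der[OF yU])
    moreover have "(\<lambda>h. - (v \<bullet> h) + k * ((\<Phi> y - u) \<bullet> \<Phi>' y h + \<Phi>' y h \<bullet> (\<Phi> y - u))) = (\<lambda>h. - (l \<bullet> h))"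
      unfolding l_def w_def inner_diff_left inner_adjoint_blinfun inner_scaleR_left
      by (auto simp: inner_commute algebra_simps)
    ultimately have D\<theta>: "(\<theta> has_derivative (\<lambda>h. - (l \<bullet> h))) (at y)" by simp
    have "norm l \<le> \<epsilon> / 2"
    proof (rule norm_le_of_inner_le_near[where x = y])
      fix \<eta> :: real assume "\<eta> > 0"
      then have "\<forall>\<^sub>F y' in at y. norm (\<theta> y' - \<theta> y + l \<bullet> (y' - y)) \<le> \<eta> * norm (y' - y)"
        using D\<theta> unfolding has_derivative_within_alt2 by simp
      moreover have "\<forall>\<^sub>F y' in at y. dist y' y < \<delta> - dist y x"
        unfolding eventually_at using yu by (intro exI[of _ "\<delta> - dist y x"]) auto
      ultimately show "\<forall>\<^sub>F y' in at y. l \<bullet> (y' - y) \<le> (\<epsilon> / 2 + \<eta>) * norm (y' - y)"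
      proof eventually_elim
        case (elim y')
        have "dist y' x \<le> \<delta>" using elim(2) dist_triangle[of y' x y] by linarith
        then have "\<theta> y + (\<epsilon>/2) * norm (y - x) \<le> \<theta> y' + (\<epsilon>/2) * norm (y' - x)"
          using min[of y' u] yu by (simp add: \<Psi>_def \<theta>_def power2_norm_eq_inner)
        moreover have "(\<epsilon>/2) * norm (y' - x) \<le> (\<epsilon>/2) * (norm (y' - y) + norm (y - x))"
          using \<epsilon> norm_triangle_ineq[of "y' - y" "y - x"] by (intro mult_left_mono) auto
        ultimately show ?case using elim(1)
          by (simp add: algebra_simps)
      qed
    qed (use \<epsilon> in simp)
    then show ?thesis by (simp add: l_def dist_norm norm_minus_commute)
  qed
  ultimately show ?thesis
    using that[of y u w] yu yU \<delta> \<epsilon> by simp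
qed

text \<open>Two approximations are composed: \<open>v\<close> by Frechet normals of the preimage,
  then these by pullbacks through the fuzzy rule. The qualification bounds the multipliers, and a
  limit of a subsequence is the required \<open>w\<close>; the bound by \<open>\<kappa>\<close>
  survives the limit.\<close>

lemma normal_cone_vimage_chain:
  fixes \<Phi> :: "'a::euclidean_space \<Rightarrow> 'b::euclidean_space" and \<Phi>' :: "'a \<Rightarrow> 'a \<Rightarrow>\<^sub>L 'b"
  assumes U: "open U" "x \<in> U"
    and der: "\<And>y. y \<in> U \<Longrightarrow> (\<Phi> has_derivative blinfun_apply (\<Phi>' y)) (at y)"
    and cont: "isCont \<Phi>' x"
    and Q: "closed Q"
    and \<delta>: "\<delta> > 0" and \<kappa>: "\<kappa> > 0"
    and qual: "\<And>y u w. dist y x < \<delta> \<Longrightarrow> dist u (\<Phi> x) < \<delta> \<Longrightarrow> w \<in> frechet_normal_cone Q u \<Longrightarrow>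
       \<kappa> * norm w \<le> norm (adjoint (blinfun_apply (\<Phi>' y)) w)"
    and v: "v \<in> normal_cone (\<Phi> -` Q \<inter> U) x"
  obtains w where "w \<in> normal_cone Q (\<Phi> x)" "v = adjoint (blinfun_apply (\<Phi>' x)) w" "\<kappa> * norm w \<le> norm v"
proof -
  have x: "\<Phi> x \<in> Q" using v by (simp add: normal_cone_def)
  have c\<Phi>: "isCont \<Phi> x" using der[OF U(2)] has_derivative_continuous by blast
  have step: "\<exists>y u w. dist y x < \<epsilon> \<and> dist u (\<Phi> x) < \<epsilon> \<and> w \<in> frechet_normal_cone Q u \<and>
      dist (adjoint (blinfun_apply (\<Phi>' y)) w) v < \<epsilon>" if \<epsilon>: "\<epsilon> > 0" for \<epsilon>
  proof -
    obtain d where d: "d > 0" "\<And>x'. dist x' x < d \<Longrightarrow> dist (\<Phi> x') (\<Phi> x) < \<epsilon> / 2"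
      using c\<Phi> \<epsilon> unfolding continuous_at_eps_delta by (metis half_gt_zero)
    obtain r where r: "r > 0" "ball x r \<subseteq> U" using U open_contains_ball by blast
    have "min (min d r) (\<epsilon> / 2) > 0" using d r \<epsilon> by simp
    then obtain x' v' where *: "v' \<in> frechet_normal_cone (\<Phi> -` Q \<inter> U) x'"
       "dist x' x < min (min d r) (\<epsilon> / 2)" "dist v' v < min (min d r) (\<epsilon> / 2)"
      using v unfolding normal_cone_iff by blast
    have "x' \<in> U" using r *(2) by (auto simp: subset_iff dist_commute)
    then obtain y u w where **: "dist y x' < \<epsilon> / 2" "dist u (\<Phi> x') < \<epsilon> / 2" "w \<in> frechet_normal_cone Q u"
        "dist (adjoint (blinfun_apply (\<Phi>' y)) w) v' < \<epsilon> / 2"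
      using fuzzy_chain_rule[OF U(1) _ der Q *(1), of "\<epsilon> / 2"] \<epsilon> by (metis half_gt_zero)
    have "dist (\<Phi> x') (\<Phi> x) < \<epsilon> / 2" using d(2)[of x'] *(2) by simp
    then show ?thesis
      using ** * dist_triangle[of y x x'] dist_triangle[of u "\<Phi> x" "\<Phi> x'"]
        dist_triangle[of "adjoint (blinfun_apply (\<Phi>' y)) w" v v']
      by (intro exI[of _ y] exI[of _ u] exI[of _ w]) simp
  qed
  \<comment> \<open>The cap \<open>\<delta>\<close> keeps \<open>y\<close> and \<open>u\<close>
    where the qualification holds; the reciprocal gives convergence.\<close>
  have "\<forall>n. \<exists>y u w. dist y x < min \<delta> (inverse (real (Suc n))) \<and> dist u (\<Phi> x) < min \<delta> (inverse (real (Suc n))) \<and>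
      w \<in> frechet_normal_cone Q u \<and> dist (adjoint (blinfun_apply (\<Phi>' y)) w) v < min \<delta> (inverse (real (Suc n)))"
    by (intro allI step) (use \<delta> in simp)
  then obtain ys us ws where s: "\<And>n. dist (ys n) x < min \<delta> (inverse (real (Suc n)))"
      "\<And>n. dist (us n) (\<Phi> x) < min \<delta> (inverse (real (Suc n)))"
      "\<And>n. ws n \<in> frechet_normal_cone Q (us n)"
      "\<And>n. dist (adjoint (blinfun_apply (\<Phi>' (ys n))) (ws n)) v < min \<delta> (inverse (real (Suc n)))"
    by metis
  have lim: "ys \<longlonglongrightarrow> x" "us \<longlonglongrightarrow> \<Phi> x" "(\<lambda>n. adjoint (blinfun_apply (\<Phi>' (ys n))) (ws n)) \<longlonglongrightarrow> v"
    by (rule metric_tendsto_imp_tendsto[OF LIMSEQ_inverse_real_of_nat];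
        use s(1,2,4)[THEN less_imp_le] in \<open>simp add: dist_real_def\<close>)+
  have low: "\<kappa> * norm (ws n) \<le> norm (adjoint (blinfun_apply (\<Phi>' (ys n))) (ws n))" for n
    by (rule qual) (use s(1-3)[of n] in auto)
  have bnd: "\<kappa> * norm (ws n) \<le> norm v + \<delta>" for n
  proof -
    have "\<kappa> * norm (ws n) \<le> norm (adjoint (blinfun_apply (\<Phi>' (ys n))) (ws n))"
      by (rule low)
    also have "\<dots> \<le> norm v + dist (adjoint (blinfun_apply (\<Phi>' (ys n))) (ws n)) v"
      by (metis add.commute dist_norm norm_triangle_sub)
    finally show ?thesis using s(4)[of n] by simp
  qed
  then have "norm (ws n) \<le> (norm v + \<delta>) / \<kappa>" for n
    using \<kappa> by (simp add: field_simps)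
  then have "bounded (range ws)" by (auto simp: bounded_iff)
  then obtain w \<phi> where w: "strict_mono \<phi>" "(ws \<circ> \<phi>) \<longlonglongrightarrow> w"
    using bounded_imp_convergent_subsequence by blast
  have l\<phi>: "(ys \<circ> \<phi>) \<longlonglongrightarrow> x" "(us \<circ> \<phi>) \<longlonglongrightarrow> \<Phi> x"
      "((\<lambda>n. adjoint (blinfun_apply (\<Phi>' (ys n))) (ws n)) \<circ> \<phi>) \<longlonglongrightarrow> v"
    using LIMSEQ_subseq_LIMSEQ[OF _ w(1)] lim by blast+
  have "w \<in> normal_cone Q (\<Phi> x)"
    by (rule normal_cone_closed_graph[OF x l\<phi>(2) w(2)])
       (use s(3) frechet_subset_normal_cone in \<open>auto intro!: always_eventually\<close>)
  moreover have "(\<lambda>n. \<Phi>' ((ys \<circ> \<phi>) n)) \<longlonglongrightarrow> \<Phi>' x"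
    by (rule isCont_tendsto_compose[OF cont l\<phi>(1)])
  then have la: "(\<lambda>n. adjoint (blinfun_apply (\<Phi>' ((ys \<circ> \<phi>) n))) ((ws \<circ> \<phi>) n)) \<longlonglongrightarrow> adjoint (blinfun_apply (\<Phi>' x)) w"
    by (rule tendsto_adjoint_blinfun) (rule w(2))
  then have eq: "v = adjoint (blinfun_apply (\<Phi>' x)) w"
    using LIMSEQ_unique l\<phi>(3) by (auto simp: o_def)
  moreover have "\<kappa> * norm w \<le> norm v"
  proof (rule LIMSEQ_le)
    show "(\<lambda>n. \<kappa> * norm ((ws \<circ> \<phi>) n)) \<longlonglongrightarrow> \<kappa> * norm w" by (intro tendsto_intros w(2))
    show "(\<lambda>n. norm (adjoint (blinfun_apply (\<Phi>' ((ys \<circ> \<phi>) n))) ((ws \<circ> \<phi>) n))) \<longlonglongrightarrow> norm v"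
      using tendsto_norm[OF la] eq by simp
    show "\<exists>N. \<forall>n\<ge>N. \<kappa> * norm ((ws \<circ> \<phi>) n) \<le> norm (adjoint (blinfun_apply (\<Phi>' ((ys \<circ> \<phi>) n))) ((ws \<circ> \<phi>) n))"
      using low by simp
  qed
  ultimately show ?thesis using that by blast
qed

subsection \<open>Normal cones of manifolds\<close>

text \<open>A subspace contains both \<open>q\<close> and \<open>- q\<close> as directions, so a
  normal annihilates it and lies in the double complement, which is \<open>T\<close>.\<close>

lemma frechet_normal_cone_orthogonal_comp:
  fixes T :: "'a::euclidean_space set"
  assumes T: "subspace T" and w: "w \<in> frechet_normal_cone (T\<^sup>\<bottom>) u"
  shows "w \<in> T"
proof -
  have sub: "subspace (T\<^sup>\<bottom>)" by (rule subspace_orthogonal_comp)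
  have u: "u \<in> T\<^sup>\<bottom>" using w by (simp add: frechet_normal_cone_def)
  have le: "w \<bullet> q \<le> 0" if q: "q \<in> T\<^sup>\<bottom>" for q
  proof (rule ccontr)
    assume neg: "\<not> w \<bullet> q \<le> 0"
    then have q0: "q \<noteq> 0" by auto
    \<comment> \<open>Half the slope of \<open>w\<close> along \<open>q\<close>; the normal
      inequality along that line would then say that a positive number is at most its half.\<close>
    define \<epsilon> where "\<epsilon> = (w \<bullet> q) / (2 * norm q)"
    have "\<epsilon> > 0" using neg q0 by (simp add: \<epsilon>_def)
    then have "\<forall>\<^sub>F y in at u within T\<^sup>\<bottom>. w \<bullet> (y - u) \<le> \<epsilon> * norm (y - u)"
      using w by (simp add: frechet_normal_cone_def)
    then obtain d where d: "d > 0"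
      "\<And>y. y \<in> T\<^sup>\<bottom> \<Longrightarrow> y \<noteq> u \<Longrightarrow> dist y u < d \<Longrightarrow> w \<bullet> (y - u) \<le> \<epsilon> * norm (y - u)"
      unfolding eventually_at by auto
    define t where "t = d / (2 * norm q)"
    have t: "t > 0" "t * norm q < d" using d q0 by (auto simp: t_def)
    have "w \<bullet> ((u + t *\<^sub>R q) - u) \<le> \<epsilon> * norm ((u + t *\<^sub>R q) - u)"
      by (rule d(2)) (use t q0 sub u q in \<open>auto simp: dist_norm subspace_add subspace_scale\<close>)
    then have "t * (w \<bullet> q) \<le> t * (\<epsilon> * norm q)" using t by (simp add: mult_ac)
    then have "w \<bullet> q \<le> (w \<bullet> q) / 2" using t q0 by (simp add: \<epsilon>_def)
    then show False using neg by simp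
  qed
  have "w \<bullet> q = 0" if q: "q \<in> T\<^sup>\<bottom>" for q
    using le[OF q] le[OF subspace_neg[OF sub q]] by simp
  then have "w \<in> T\<^sup>\<bottom>\<^sup>\<bottom>"
    by (auto simp: orthogonal_comp_def orthogonal_def inner_commute)
  then show ?thesis using orthogonal_comp_self[OF T] by simp
qed

text \<open>As the defining map takes values in \<open>T\<close>, its zero set is also the preimage of the orthogonal
  complement of \<open>T\<close>. The normals of that set lie in \<open>T\<close>, on which the adjoint derivative is injective,
  so the chain rule applies even when \<open>T\<close> is a proper subspace.\<close>

lemma normal_cone_manifold:
  fixes M :: "'a::euclidean_space set"
  assumes "manifold_around C1_map_on M z"
  obtains V where "open V" "z \<in> V" "\<And>y. y \<in> V \<Longrightarrow> normal_cone M y \<subseteq> frechet_normal_cone M y"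
proof -
  obtain U T and F :: "'a \<Rightarrow> 'a" where U: "open U" "z \<in> U" and T: "subspace T" "F ` U \<subseteq> T"
    and F: "C1_map_on F U" "range (frechet_derivative F (at z)) = T" and M: "M \<inter> U = {y \<in> U. F y = 0}"
    using assms unfolding manifold_around_def by blast
  obtain F' :: "'a \<Rightarrow> 'a \<Rightarrow>\<^sub>L 'a" where F': "\<And>y. y \<in> U \<Longrightarrow> (F has_derivative blinfun_apply (F' y)) (at y)"
      "continuous_on U F'"
    using F(1) unfolding C1_map_on_def by blast
  have rng: "range (blinfun_apply (F' z)) = T"
    using F(2) frechet_derivative_at[OF F'(1)[OF U(2)]] by simp
  obtain e where e: "e > 0" "\<And>w. w \<in> T \<Longrightarrow> e * norm w \<le> norm (adjoint (blinfun_apply (F' z)) w)"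
  proof -
    have "\<exists>e>0. \<forall>w\<in>T. norm (adjoint (blinfun_apply (F' z)) w) \<ge> e * norm w"
    proof (rule injective_imp_isometric)
      show "closed T" "subspace T" using T closed_subspace by auto
      show "bounded_linear (adjoint (blinfun_apply (F' z)))"
        using linear_adjoint_blinfun linear_conv_bounded_linear by blast
      show "\<forall>w\<in>T. adjoint (blinfun_apply (F' z)) w = 0 \<longrightarrow> w = 0"
      proof (intro ballI impI)
        fix w assume w: "w \<in> T" "adjoint (blinfun_apply (F' z)) w = 0"
        \<comment> \<open>On the range, injectivity is automatic: pairing \<open>w = F' z d\<close>
          with itself moves one factor to the adjoint.\<close>
        obtain d where "w = F' z d" using w(1) rng by auto
        then have "w \<bullet> w = adjoint (blinfun_apply (F' z)) w \<bullet> d" by (simp add: inner_adjoint_blinfun)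
        then show "w = 0" using w(2) by simp
      qed
    qed
    then show ?thesis using that by blast
  qed
  have "isCont F' z" using F'(2) U by (simp add: continuous_on_eq_continuous_at)
  \<comment> \<open>A perturbation of the derivative by less than \<open>e / 2\<close> leaves half
    of the lower bound, uniformly near \<open>z\<close>.\<close>
  then obtain d where d: "d > 0" "\<And>y. dist y z < d \<Longrightarrow> dist (F' y) (F' z) < e / 2"
    using e(1) unfolding continuous_at_eps_delta by (metis half_gt_zero)
  have low: "(e/2) * norm w \<le> norm (adjoint (blinfun_apply (F' y)) w)" if "dist y z < d" "w \<in> T" for y w
  proof -
    have "norm (adjoint (blinfun_apply (F' z)) w - adjoint (blinfun_apply (F' y)) w) \<le> norm (F' z - F' y) * norm w"
      unfolding adjoint_blinfun_diff by (rule norm_adjoint_blinfun_le)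
    also have "\<dots> \<le> (e/2) * norm w"
      using d(2)[OF that(1)] by (intro mult_right_mono) (auto simp: dist_norm norm_minus_commute)
    finally have "norm (adjoint (blinfun_apply (F' z)) w) - norm (adjoint (blinfun_apply (F' y)) w) \<le> (e/2) * norm w"
      using norm_triangle_ineq2 order_trans by blast
    then show ?thesis using e(2)[OF that(2)] by simp
  qed
  have zeros: "F -` (T\<^sup>\<bottom>) \<inter> U = M \<inter> U"
  proof -
    have "F y = 0" if "y \<in> U" "F y \<in> T\<^sup>\<bottom>" for y
    proof -
      have "F y \<in> T" using that T(2) by blast
      with that(2) have "F y \<bullet> F y = 0" by (auto simp: orthogonal_comp_def orthogonal_def)
      then show ?thesis by simp
    qed
    then show ?thesis unfolding M using subspace_0[OF subspace_orthogonal_comp] by auto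
  qed
  have "normal_cone M y \<subseteq> frechet_normal_cone M y" if y: "y \<in> U \<inter> ball z d" for y
  proof
    fix v assume "v \<in> normal_cone M y"
    then have v: "v \<in> normal_cone (F -` (T\<^sup>\<bottom>) \<inter> U) y"
      using y U normal_cone_Int_open[of U y M] zeros by auto
    have yM: "y \<in> M \<inter> U" using v zeros by (auto simp: normal_cone_def)
    obtain w where w: "v = adjoint (blinfun_apply (F' y)) w"
    proof (rule normal_cone_vimage_chain[OF U(1) _ F'(1) _ _ _ _ _ v, where \<delta> = "d - dist y z" and \<kappa> = "e/2"])
      show "closed (T\<^sup>\<bottom>)" by (rule closed_subspace[OF subspace_orthogonal_comp])
      show "isCont F' y" using F'(2) U y by (simp add: continuous_on_eq_continuous_at)
      fix y' u w assume "dist y' y < d - dist y z" "w \<in> frechet_normal_cone (T\<^sup>\<bottom>) u"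
      then show "e/2 * norm w \<le> norm (adjoint (blinfun_apply (F' y')) w)"
        using low frechet_normal_cone_orthogonal_comp[OF T(1)] dist_triangle[of y' z y] by auto
    qed (use y e in \<open>auto simp: dist_commute\<close>)
    \<comment> \<open>Every vector is a Frechet normal to a singleton, so the pullback of
      \<open>w\<close> under \<open>F\<close>, with target \<open>{0}\<close>, is a Frechet normal
      to the zero set.\<close>
    have "v \<in> frechet_normal_cone (M \<inter> U) y"
      unfolding w
      by (rule adjoint_in_frechet_normal_cone[where \<Phi> = F and Y = "{0}"])
         (use yM y M F' in \<open>auto simp: frechet_normal_cone_def eventually_at_filter\<close>)
    then show "v \<in> frechet_normal_cone M y"
      using frechet_normal_cone_Int_open[OF U(1), of y M] y by auto
  qed
  then show ?thesis using that[of "U \<inter> ball z d"] U d by auto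
qed

section \<open>Strong (a) as a norm estimate\<close>

text \<open>Positive homogeneity extends the gap from unit normals to all normals. The distance is
  attained because the limiting cone is closed, so an actual nearby normal of \<open>Y\<close> is
  available.\<close>

lemma strongly_a_regularE:
  assumes "strongly_a_regular X Y"
  obtains C where "C > 0"
    "\<And>x y v. x \<in> X \<Longrightarrow> y \<in> Y \<Longrightarrow> v \<in> normal_cone X x \<Longrightarrow>
       \<exists>w\<in>normal_cone Y y. norm (v - w) \<le> C * norm (x - y) * norm v"
proof -
  obtain C where C: "C > 0" "\<And>x y. x \<in> X \<Longrightarrow> y \<in> Y \<Longrightarrow>
      cone_gap (normal_cone X x) (normal_cone Y y) \<le> ennreal (C * norm (x - y))"
    using assms unfolding strongly_a_regular_def by blast
  have "\<exists>w\<in>normal_cone Y y. norm (v - w) \<le> C * norm (x - y) * norm v"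
    if x: "x \<in> X" and y: "y \<in> Y" and v: "v \<in> normal_cone X x" for x y v
  proof (cases "v = 0")
    case True
    then show ?thesis using zero_in_normal_cone[OF y] by (intro bexI[of _ 0]) auto
  next
    case False
    define u where "u = (1 / norm v) *\<^sub>R v"
    have u: "u \<in> normal_cone X x" "norm u = 1" "v = norm v *\<^sub>R u"
      using False normal_cone_scale[OF v, of "1 / norm v"] by (auto simp: u_def)
    have "ennreal (infdist u (normal_cone Y y)) \<le> cone_gap (normal_cone X x) (normal_cone Y y)"
      unfolding cone_gap_def using u by (intro SUP_upper) simp
    also have "\<dots> \<le> ennreal (C * norm (x - y))" using C(2) x y by blast
    finally have le: "infdist u (normal_cone Y y) \<le> C * norm (x - y)"
      using C(1) by (simp add: ennreal_le_iff)
    obtain w where w: "w \<in> normal_cone Y y" "infdist u (normal_cone Y y) = dist u w"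
      using infdist_attains_inf[OF closed_normal_cone, of Y y u] zero_in_normal_cone[OF y] by blast
    have "norm (v - norm v *\<^sub>R w) = norm v * norm (u - w)"
      by (subst (1) u(3)) (simp flip: scaleR_diff_right)
    also have "\<dots> \<le> norm v * (C * norm (x - y))"
      using le w(2) by (intro mult_left_mono) (auto simp: dist_norm)
    finally show ?thesis
      using normal_cone_scale[OF w(1), of "norm v"] by (auto simp: mult_ac)
  qed
  then show ?thesis using that C(1) by blast
qed

lemma strongly_a_regularI:
  assumes C: "C > 0" and
    approx: "\<And>x y v. x \<in> X \<Longrightarrow> y \<in> Y \<Longrightarrow> v \<in> normal_cone X x \<Longrightarrow>
       \<exists>w\<in>normal_cone Y y. norm (v - w) \<le> C * norm (x - y) * norm v"
  shows "strongly_a_regular X Y"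
  unfolding strongly_a_regular_def cone_gap_def
proof (intro exI[of _ C] conjI ballI SUP_least ennreal_leI)
  fix x y v assume "x \<in> X" "y \<in> Y" "v \<in> {u \<in> normal_cone X x. norm u = 1}"
  moreover from this obtain w where "w\<in>normal_cone Y y" "norm (v - w) \<le> C * norm (x - y) * norm v"
    using approx by blast
  ultimately show "infdist v (normal_cone Y y) \<le> C * norm (x - y)"
    using infdist_le2[of w "normal_cone Y y" v] by (simp add: dist_norm)
qed (use C in auto)

text \<open>A convergent subsequence of normals is bounded, so its distance to suitable normals at
  \<open>y\<close> vanishes, and the cone at \<open>y\<close> is closed.\<close>

lemma strongly_a_regular_imp_a_regular:
  assumes "strongly_a_regular X Y"
  shows "a_regular X Y"
  unfolding a_regular_def
proof (intro allI impI, elim conjE)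
  fix xs vs y w and \<phi> :: "nat \<Rightarrow> nat"
  assume xs: "\<forall>i::nat. xs i \<in> X" and y: "y \<in> Y" and lim: "xs \<longlonglongrightarrow> y"
    and vs: "\<forall>i. vs i \<in> normal_cone X (xs i)" and \<phi>: "strict_mono \<phi>" "(vs \<circ> \<phi>) \<longlonglongrightarrow> w"
  obtain C where C: "\<And>x y v. x \<in> X \<Longrightarrow> y \<in> Y \<Longrightarrow> v \<in> normal_cone X x \<Longrightarrow>
       \<exists>w\<in>normal_cone Y y. norm (v - w) \<le> C * norm (x - y) * norm v"
    using strongly_a_regularE[OF assms] by metis
  have "\<exists>w\<in>normal_cone Y y. norm ((vs \<circ> \<phi>) i - w) \<le> C * norm ((xs \<circ> \<phi>) i - y) * norm ((vs \<circ> \<phi>) i)" for i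
    by (rule C[OF _ y]) (use xs vs in auto)
  then obtain ws where ws: "\<And>i. ws i \<in> normal_cone Y y"
      "\<And>i. norm ((vs \<circ> \<phi>) i - ws i) \<le> C * norm ((xs \<circ> \<phi>) i - y) * norm ((vs \<circ> \<phi>) i)"
    by metis
  have "(xs \<circ> \<phi>) \<longlonglongrightarrow> y" using LIMSEQ_subseq_LIMSEQ[OF lim \<phi>(1)] .
  then have "(\<lambda>i. C * norm ((xs \<circ> \<phi>) i - y) * norm ((vs \<circ> \<phi>) i)) \<longlonglongrightarrow> C * norm (y - y) * norm w"
    using \<phi>(2) by (intro tendsto_mult tendsto_norm tendsto_diff tendsto_const)
  then have "(\<lambda>i. C * norm ((xs \<circ> \<phi>) i - y) * norm ((vs \<circ> \<phi>) i)) \<longlonglongrightarrow> 0"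
    by simp
  then have "(\<lambda>i. (vs \<circ> \<phi>) i - ws i) \<longlonglongrightarrow> 0"
    by (rule Lim_null_comparison[OF always_eventually, rotated]) (use ws(2) in blast)
  then have "ws \<longlonglongrightarrow> w" using Lim_transform2 \<phi>(2) by blast
  then show "w \<in> normal_cone Y y"
    using closed_normal_cone ws(1) closed_sequentially by blast
qed

section \<open>Mean value estimates\<close>

lemma C1_lipschitz_on_cball:
  fixes f :: "'a::euclidean_space \<Rightarrow> 'b::real_normed_vector"
  assumes der: "\<And>x. (f has_derivative blinfun_apply (f' x)) (at x)"
    and cont: "continuous_on UNIV f'"
  obtains B where "B > 0" "\<And>x y. x \<in> cball a r \<Longrightarrow> y \<in> cball a r \<Longrightarrow> norm (f x - f y) \<le> B * norm (x - y)"
proof -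
  have "compact (f' ` cball a r)"
    by (intro compact_continuous_image continuous_on_subset[OF cont]) auto
  then obtain B where B: "B > 0" "\<And>x. x \<in> cball a r \<Longrightarrow> norm (f' x) \<le> B"
    using compact_imp_bounded bounded_pos by (metis imageI)
  have "norm (f x - f y) \<le> B * norm (x - y)" if "x \<in> cball a r" "y \<in> cball a r" for x y
    by (rule differentiable_bound[where S = "cball a r" and f' = "\<lambda>x. blinfun_apply (f' x)"])
       (use that B der in \<open>auto intro: has_derivative_at_withinI simp flip: norm_blinfun.rep_eq\<close>)
  then show ?thesis using that B by blast
qed

text \<open>Serves both orders of smoothness: \<open>b\<close> is a small constant under uniform
  continuity of the derivative, and proportional to \<open>norm (y - x)\<close> under a Lipschitz
  derivative.\<close>

lemma C1_remainder_bound: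
  fixes f :: "'a::euclidean_space \<Rightarrow> 'b::real_normed_vector"
  assumes der: "\<And>x. (f has_derivative blinfun_apply (f' x)) (at x)"
    and b: "\<And>z. z \<in> closed_segment x y \<Longrightarrow> norm (f' z - f' x) \<le> b"
  shows "norm (f y - f x - f' x (y - x)) \<le> b * norm (y - x)"
proof -
  have "norm (f y - f x - f' x (y - x)) \<le> norm (y - x) * b"
  proof (rule differentiable_bound_linearization[where S = "closed_segment x y" and f' = "\<lambda>x. blinfun_apply (f' x)" and ?x0.0 = x])
    show "x + t *\<^sub>R (y - x) \<in> closed_segment x y" if "t \<in> {0..1}" for t
      using that by (auto simp: in_segment algebra_simps intro!: exI[of _ t])
    show "onorm (blinfun_apply (f' z) - blinfun_apply (f' x)) \<le> b" if "z \<in> closed_segment x y" for z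
      using b[OF that] by (simp add: norm_blinfun.rep_eq minus_blinfun.rep_eq fun_diff_def)
  qed (use der in \<open>auto intro: has_derivative_at_withinI\<close>)
  then show ?thesis by (simp add: mult.commute)
qed

section \<open>The three (b) conditions in a common epsilon-delta form\<close>

text \<open>All three functions are positively homogeneous and change by at most
  \<open>\<bar>e\<bar>\<close> under a perturbation \<open>e\<close>; these facts let one argument
  treat the three signs together.\<close>

definition rel_part :: "rel_sign \<Rightarrow> real \<Rightarrow> real" where
  "rel_part d s = (case d of LE \<Rightarrow> s | EQ \<Rightarrow> \<bar>s\<bar> | GE \<Rightarrow> - s)"

lemma rel_bound_iff: "rel_bound d s t \<longleftrightarrow> rel_part d s \<le> t"
  by (cases d) (auto simp: rel_part_def)

lemma rel_part_zero [simp]: "rel_part d 0 = 0"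
  by (cases d) (auto simp: rel_part_def)

lemma rel_part_le_abs: "rel_part d s \<le> \<bar>s\<bar>"
  by (cases d) (auto simp: rel_part_def)

lemma rel_part_mult: "c \<ge> 0 \<Longrightarrow> rel_part d (c * s) = c * rel_part d s"
  by (cases d) (auto simp: rel_part_def abs_mult)

lemma rel_part_add: "rel_part d (s + e) \<le> rel_part d s + \<bar>e\<bar>"
  by (cases d) (auto simp: rel_part_def)

text \<open>The least admissible error function is built directly, as the supremum over all pairs at
  distance exactly \<open>t\<close>.\<close>

lemma b_regularI:
  assumes "\<And>\<epsilon>. \<epsilon> > 0 \<Longrightarrow> \<exists>\<delta>>0. \<forall>x\<in>X. \<forall>y\<in>Y. \<forall>v\<in>normal_cone X x \<inter> cball 0 1.
     norm (y - x) < \<delta> \<longrightarrow> rel_part d (v \<bullet> (y - x)) \<le> \<epsilon> * norm (y - x)"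
  shows "b_regular d X Y"
proof -
  define S where "S t = {rel_part d (v \<bullet> (y - x)) | x y v. x \<in> X \<and> y \<in> Y \<and>
      v \<in> normal_cone X x \<inter> cball 0 1 \<and> norm (y - x) = t}" for t
  \<comment> \<open>Inserting \<open>0\<close> makes the set nonempty and \<open>\<omega>\<close>
    nonnegative; the set is bounded since Cauchy-Schwarz caps its members by
    \<open>t\<close>.\<close>
  define \<omega> where "\<omega> t = Sup (insert 0 (S t))" for t
  have le: "s \<le> t" if "s \<in> S t" for s t
  proof -
    obtain x y v where *: "x \<in> X" "s = rel_part d (v \<bullet> (y - x))" "norm v \<le> 1" "norm (y - x) = t"
      using \<open>s \<in> S t\<close> unfolding S_def mem_Collect_eq Int_iff mem_cball_0 by blast
    have "s \<le> \<bar>v \<bullet> (y - x)\<bar>" using rel_part_le_abs *(2) by simp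
    also have "\<dots> \<le> norm v * norm (y - x)" by (rule Cauchy_Schwarz_ineq2)
    also have "\<dots> \<le> 1 * t" using * by (intro mult_mono) auto
    finally show ?thesis by simp
  qed
  have bdd: "bdd_above (insert 0 (S t))" for t
    using le by (auto simp: bdd_above_def intro!: exI[of _ "max 0 t"] le_max_iff_disj[THEN iffD2])
  have \<omega>0: "\<omega> t \<ge> 0" for t unfolding \<omega>_def by (rule cSup_upper) (use bdd in auto)
  show ?thesis
    unfolding b_regular_def rel_bound_iff
  proof (intro exI[of _ \<omega>] conjI ballI)
    fix x y v assume "x \<in> X" "y \<in> Y" "v \<in> normal_cone X x \<inter> cball 0 1"
    then have "rel_part d (v \<bullet> (y - x)) \<in> S (norm (y - x))" unfolding S_def by blast
    then show "rel_part d (v \<bullet> (y - x)) \<le> \<omega> (norm (y - x))"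
      unfolding \<omega>_def by (intro cSup_upper bdd) auto
  next
    show "((\<lambda>t. \<omega> t / t) \<longlongrightarrow> 0) (at_right 0)"
    proof (rule tendstoI)
      fix \<epsilon> :: real assume "\<epsilon> > 0"
      then obtain \<delta> where \<delta>: "\<delta> > 0" "\<And>x y v. x \<in> X \<Longrightarrow> y \<in> Y \<Longrightarrow> v \<in> normal_cone X x \<inter> cball 0 1 \<Longrightarrow>
         norm (y - x) < \<delta> \<Longrightarrow> rel_part d (v \<bullet> (y - x)) \<le> \<epsilon> / 2 * norm (y - x)"
        using assms[of "\<epsilon> / 2"] by auto
      have "\<forall>\<^sub>F t in at_right 0. t \<in> {0<..<\<delta>}"
        by (rule eventually_at_right_real[OF \<delta>(1)])
      then show "\<forall>\<^sub>F t in at_right 0. dist (\<omega> t / t) 0 < \<epsilon>"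
      proof eventually_elim
        case (elim t)
        have "\<omega> t \<le> \<epsilon> / 2 * t"
          unfolding \<omega>_def
        proof (rule cSup_least)
          fix s assume "s \<in> insert 0 (S t)"
          then show "s \<le> \<epsilon> / 2 * t"
            using \<delta>(2) elim \<open>\<epsilon> > 0\<close> by (auto simp: S_def)
        qed simp
        also have "\<dots> < \<epsilon> * t" using elim \<open>\<epsilon> > 0\<close> by simp
        finally show ?case using elim \<omega>0[of t] by (simp add: field_simps)
      qed
    qed
  qed
qed

lemma b_regularD:
  assumes "b_regular d X Y" "\<epsilon> > 0"
  obtains \<delta> where "\<delta> > 0" "\<And>x y v. x \<in> X \<Longrightarrow> y \<in> Y \<Longrightarrow> v \<in> normal_cone X x \<inter> cball 0 1 \<Longrightarrow>
     norm (y - x) < \<delta> \<Longrightarrow> rel_part d (v \<bullet> (y - x)) \<le> \<epsilon> * norm (y - x)"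
proof -
  obtain \<omega> :: "real \<Rightarrow> real" where \<omega>: "((\<lambda>t. \<omega> t / t) \<longlongrightarrow> 0) (at_right 0)"
    "\<And>x y v. x \<in> X \<Longrightarrow> y \<in> Y \<Longrightarrow> v \<in> normal_cone X x \<inter> cball 0 1 \<Longrightarrow>
       rel_part d (v \<bullet> (y - x)) \<le> \<omega> (norm (y - x))"
    using assms(1) unfolding b_regular_def rel_bound_iff by blast
  have "\<forall>\<^sub>F t in at_right 0. dist (\<omega> t / t) 0 < \<epsilon>"
    using \<omega>(1) assms(2) by (rule tendstoD)
  then obtain \<delta> where \<delta>: "\<delta> > 0" "\<And>t. t > 0 \<Longrightarrow> t < \<delta> \<Longrightarrow> \<bar>\<omega> t / t\<bar> < \<epsilon>"
    unfolding eventually_at_right_field by auto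
  show ?thesis
  proof (rule that[OF \<delta>(1)])
    fix x y v assume *: "x \<in> X" "y \<in> Y" "v \<in> normal_cone X x \<inter> cball 0 1" "norm (y - x) < \<delta>"
    show "rel_part d (v \<bullet> (y - x)) \<le> \<epsilon> * norm (y - x)"
    \<comment> \<open>The limit says nothing about \<open>\<omega> 0\<close>, but at distance zero
      both sides vanish.\<close>
    proof (cases "y = x")
      case False
      then have "\<bar>\<omega> (norm (y - x)) / norm (y - x)\<bar> < \<epsilon>" using \<delta>(2) *(4) by simp
      then have "\<omega> (norm (y - x)) / norm (y - x) \<le> \<epsilon>" by linarith
      then have "\<omega> (norm (y - x)) \<le> \<epsilon> * norm (y - x)" using False by (simp add: field_simps)
      then show ?thesis using \<omega>(2)[OF *(1-3)] by simp
    qed simp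
  qed
qed

subsection \<open>Regularity of transversal preimages\<close>

text \<open>Of the manifold structure only the agreement of the two normal cones of \<open>Y\<close>
  near the base point is retained, so the transport works at the level of sets.\<close>

locale transversal_preimage =
  fixes \<Phi> :: "'v::euclidean_space \<Rightarrow> 'u::euclidean_space"
    and \<Phi>' :: "'v \<Rightarrow> 'v \<Rightarrow>\<^sub>L 'u"
    and X Y :: "'u set" and xb :: 'v
  assumes der: "\<And>x. (\<Phi> has_derivative blinfun_apply (\<Phi>' x)) (at x)"
    and cont: "continuous_on UNIV \<Phi>'"
    and closed_X: "closed X"
    and a_reg: "reg_near a_regular X Y (\<Phi> xb)"
    and normal_Y: "\<exists>V. open V \<and> \<Phi> xb \<in> V \<and> (\<forall>y\<in>V. normal_cone Y y \<subseteq> frechet_normal_cone Y y)"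
    and transversal: "\<And>w. w \<in> normal_cone Y (\<Phi> xb) \<Longrightarrow> adjoint (blinfun_apply (\<Phi>' xb)) w = 0 \<Longrightarrow> w = 0"
begin

lemma isCont_derivative: "isCont \<Phi>' x"
  using cont by (simp add: continuous_on_eq_continuous_at)

lemma isCont_map: "isCont \<Phi> x"
  using der has_derivative_continuous by blast

lemma in_Y: "\<Phi> xb \<in> Y"
  using a_reg by (simp add: reg_near_def)

text \<open>Unit normals violating the bound ever more closely to \<open>\<Phi> xb\<close> would accumulate, by \<open>(a)\<close>-regularity,
  at a unit normal of \<open>Y\<close> that contradicts transversality.\<close>

lemma adjoint_lower_bound:
  obtains \<kappa> \<delta> where "\<kappa> > 0" "\<delta> > 0"
    "\<And>y u w. dist y xb < \<delta> \<Longrightarrow> dist u (\<Phi> xb) < \<delta> \<Longrightarrow> w \<in> normal_cone X u \<Longrightarrow>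
       \<kappa> * norm w \<le> norm (adjoint (blinfun_apply (\<Phi>' y)) w)"
proof (rule ccontr)
  assume neg: "\<not> thesis"
  obtain U where U: "open U" "\<Phi> xb \<in> U" "a_regular (X \<inter> U) (Y \<inter> U)"
    using a_reg unfolding reg_near_def by blast
  obtain r where r: "r > 0" "ball (\<Phi> xb) r \<subseteq> U" using U open_contains_ball by blast
  \<comment> \<open>The cap \<open>r\<close> keeps the points \<open>us n\<close> in
    \<open>U\<close>, where (a)-regularity is available.\<close>
  define e where "e n = min r (inverse (real (Suc n)))" for n
  have e: "e n > 0" "e n \<le> r" "e n \<le> inverse (real (Suc n))" for n
    using r by (auto simp: e_def)
  have el: "e \<longlonglongrightarrow> 0"
    by (rule metric_tendsto_imp_tendsto[OF LIMSEQ_inverse_real_of_nat])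
       (use e(1)[THEN less_imp_le] e(3) in \<open>simp add: dist_real_def\<close>)
  have "\<exists>y u w. dist y xb < e n \<and> dist u (\<Phi> xb) < e n \<and> w \<in> normal_cone X u \<and>
      norm (adjoint (blinfun_apply (\<Phi>' y)) w) < e n * norm w" for n
    using neg that[of "e n" "e n"] e(1)[of n] by (meson not_le)
  then obtain ys us ws where s: "\<And>n. dist (ys n) xb < e n" "\<And>n. dist (us n) (\<Phi> xb) < e n"
      "\<And>n. ws n \<in> normal_cone X (us n)"
      "\<And>n. norm (adjoint (blinfun_apply (\<Phi>' (ys n))) (ws n)) < e n * norm (ws n)"
    by metis
  define vs where "vs n = (1 / norm (ws n)) *\<^sub>R ws n" for n
  \<comment> \<open>The violated bound is strict, which excludes zero and permits
    normalization.\<close>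
  have ws0: "ws n \<noteq> 0" for n
    using s(4)[of n] by (metis mult_zero_right norm_ge_zero norm_zero not_le)
  have vs: "vs n \<in> normal_cone X (us n)" "norm (vs n) = 1" for n
    using ws0[of n] normal_cone_scale[OF s(3)[of n], of "1 / norm (ws n)"] by (auto simp: vs_def)
  have adj: "norm (adjoint (blinfun_apply (\<Phi>' (ys n))) (vs n)) \<le> e n" for n
    using s(4)[of n] ws0[of n] unfolding vs_def linear_scale[OF linear_adjoint_blinfun]
    by (simp add: field_simps)
  have lim: "ys \<longlonglongrightarrow> xb" "us \<longlonglongrightarrow> \<Phi> xb" "(\<lambda>n. adjoint (blinfun_apply (\<Phi>' (ys n))) (vs n)) \<longlonglongrightarrow> 0"
    by (rule metric_tendsto_imp_tendsto[OF el];
        use s(1,2)[THEN less_imp_le] adj e(1)[THEN less_imp_le] in \<open>simp add: dist_real_def\<close>)+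
  have "bounded (range vs)" using vs(2) by (auto simp: bounded_iff intro!: exI[of _ 1])
  then obtain w \<phi> where w: "strict_mono \<phi>" "(vs \<circ> \<phi>) \<longlonglongrightarrow> w"
    using bounded_imp_convergent_subsequence by blast
  have l\<phi>: "(ys \<circ> \<phi>) \<longlonglongrightarrow> xb" "((\<lambda>n. adjoint (blinfun_apply (\<Phi>' (ys n))) (vs n)) \<circ> \<phi>) \<longlonglongrightarrow> 0"
    using LIMSEQ_subseq_LIMSEQ[OF _ w(1)] lim by blast+
  have usU: "us n \<in> U" for n
    using s(2)[of n] e(2)[of n] r(2) by (auto simp: subset_iff dist_commute)
  have usX: "us n \<in> X" for n
    using vs(1)[of n] by (simp add: normal_cone_def)
  have "w \<in> normal_cone (Y \<inter> U) (\<Phi> xb)"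
    using U(3)[unfolded a_regular_def, rule_format, of us "\<Phi> xb" vs \<phi> w]
      usU usX vs(1) lim(2) w in_Y U(2) normal_cone_Int_open[OF U(1)] by auto
  then have "w \<in> normal_cone Y (\<Phi> xb)" using normal_cone_Int_open[OF U(1,2)] by simp
  moreover have "adjoint (blinfun_apply (\<Phi>' xb)) w = 0"
  proof -
    have "(\<lambda>n. \<Phi>' ((ys \<circ> \<phi>) n)) \<longlonglongrightarrow> \<Phi>' xb"
      by (rule isCont_tendsto_compose[OF isCont_derivative l\<phi>(1)])
    then have "(\<lambda>n. adjoint (blinfun_apply (\<Phi>' ((ys \<circ> \<phi>) n))) ((vs \<circ> \<phi>) n)) \<longlonglongrightarrow> adjoint (blinfun_apply (\<Phi>' xb)) w"
      by (rule tendsto_adjoint_blinfun) (rule w(2))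
    then show ?thesis
      using LIMSEQ_unique l\<phi>(2) by (auto simp: o_def)
  qed
  ultimately have "w = 0" by (rule transversal)
  moreover have "norm w = 1"
    using LIMSEQ_unique[OF tendsto_norm[OF w(2)], of 1] vs(2) by simp
  ultimately show False by simp
qed

text \<open>For \<open>X\<close> the qualified chain rule is applied at every nearby point, with
  \<open>\<delta> / 2\<close> left for the approximations. For \<open>Y\<close> a limiting normal is
  already a Frechet normal, whose pullback needs no qualification.\<close>

lemma normal_cones_vimage:
  obtains \<kappa> r where "\<kappa> > 0" "r > 0"
    "\<And>x v. x \<in> ball xb r \<Longrightarrow> v \<in> normal_cone (\<Phi> -` X) x \<Longrightarrow>
       \<exists>w\<in>normal_cone X (\<Phi> x). v = adjoint (blinfun_apply (\<Phi>' x)) w \<and> \<kappa> * norm w \<le> norm v"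
    "\<And>x w. x \<in> ball xb r \<Longrightarrow> w \<in> normal_cone Y (\<Phi> x) \<Longrightarrow>
       adjoint (blinfun_apply (\<Phi>' x)) w \<in> normal_cone (\<Phi> -` Y) x"
proof -
  obtain \<kappa> \<delta> where \<kappa>: "\<kappa> > 0" "\<delta> > 0"
    "\<And>y u w. dist y xb < \<delta> \<Longrightarrow> dist u (\<Phi> xb) < \<delta> \<Longrightarrow> w \<in> normal_cone X u \<Longrightarrow>
       \<kappa> * norm w \<le> norm (adjoint (blinfun_apply (\<Phi>' y)) w)"
    using adjoint_lower_bound by blast
  obtain V where V: "open V" "\<Phi> xb \<in> V" "\<And>y. y \<in> V \<Longrightarrow> normal_cone Y y \<subseteq> frechet_normal_cone Y y"
    using normal_Y by blast
  have "open (\<Phi> -` (V \<inter> ball (\<Phi> xb) (\<delta> / 2)))"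
    using V(1) isCont_map by (intro continuous_open_vimage open_Int) auto
  moreover have "xb \<in> \<Phi> -` (V \<inter> ball (\<Phi> xb) (\<delta> / 2))" using V \<kappa> by simp
  ultimately obtain r0 where r0: "r0 > 0" "ball xb r0 \<subseteq> \<Phi> -` (V \<inter> ball (\<Phi> xb) (\<delta> / 2))"
    using open_contains_ball by blast
  show ?thesis
  proof (rule that[of \<kappa> "min r0 (\<delta> / 2)"])
    fix x v assume x: "x \<in> ball xb (min r0 (\<delta> / 2))" and v: "v \<in> normal_cone (\<Phi> -` X) x"
    have xd: "dist x xb < \<delta> / 2" "dist (\<Phi> x) (\<Phi> xb) < \<delta> / 2"
      using x r0(2) by (auto simp: dist_commute subset_iff)
    have v': "v \<in> normal_cone (\<Phi> -` X \<inter> UNIV) x" using v by simp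
    obtain w where "w \<in> normal_cone X (\<Phi> x)" "v = adjoint (blinfun_apply (\<Phi>' x)) w" "\<kappa> * norm w \<le> norm v"
    proof (rule normal_cone_vimage_chain[OF open_UNIV UNIV_I der isCont_derivative closed_X _ \<kappa>(1) _ v', where \<delta> = "\<delta> / 2"])
      fix y u w assume "dist y x < \<delta> / 2" "dist u (\<Phi> x) < \<delta> / 2" "w \<in> frechet_normal_cone X u"
      then show "\<kappa> * norm w \<le> norm (adjoint (blinfun_apply (\<Phi>' y)) w)"
        using xd dist_triangle[of y xb x] dist_triangle[of u "\<Phi> xb" "\<Phi> x"] frechet_subset_normal_cone
        by (intro \<kappa>(3)[of y u]) auto
    qed (use \<kappa> in auto)
    then show "\<exists>w\<in>normal_cone X (\<Phi> x). v = adjoint (blinfun_apply (\<Phi>' x)) w \<and> \<kappa> * norm w \<le> norm v"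
      by blast
  next
    fix x w assume x: "x \<in> ball xb (min r0 (\<delta> / 2))" and w: "w \<in> normal_cone Y (\<Phi> x)"
    have "\<Phi> x \<in> V" using x r0(2) by (auto simp: subset_iff)
    then have "w \<in> frechet_normal_cone Y (\<Phi> x)" using V(3) w by blast
    moreover have "x \<in> \<Phi> -` Y" using w by (simp add: normal_cone_def)
    ultimately have "adjoint (blinfun_apply (\<Phi>' x)) w \<in> frechet_normal_cone (\<Phi> -` Y) x"
      by (intro adjoint_in_frechet_normal_cone[OF der]) (auto simp: eventually_at_filter)
    then show "adjoint (blinfun_apply (\<Phi>' x)) w \<in> normal_cone (\<Phi> -` Y) x"
      using frechet_subset_normal_cone by blast
  qed (use \<kappa> r0 in auto)
qed

lemma reg_near_vimageI:
  assumes "open U" "\<Phi> xb \<in> U" "r > 0"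
    and "P (\<Phi> -` X \<inter> (ball xb r \<inter> \<Phi> -` U)) (\<Phi> -` Y \<inter> (ball xb r \<inter> \<Phi> -` U))"
  shows "reg_near P (\<Phi> -` X) (\<Phi> -` Y) xb"
proof -
  have "open (ball xb r \<inter> \<Phi> -` U)"
    using assms(1) isCont_map by (intro open_Int continuous_open_vimage) auto
  then show ?thesis
    unfolding reg_near_def using assms in_Y by (intro conjI exI[of _ "ball xb r \<inter> \<Phi> -` U"]) auto
qed

lemma normal_cone_vimage_Int:
  assumes "open U" "x \<in> ball xb r \<inter> \<Phi> -` U"
  shows "normal_cone (Q \<inter> (ball xb r \<inter> \<Phi> -` U)) x = normal_cone Q x"
  by (rule normal_cone_Int_open)
     (use assms isCont_map in \<open>auto intro!: open_Int continuous_open_vimage\<close>)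

text \<open>The normals are lifted to multipliers, which \<open>\<kappa>\<close> bounds along the
  convergent subsequence; a further subsequence converges to a normal of \<open>Y\<close>, and
  pulling this limit back returns \<open>v\<close>.\<close>

lemma a_regular_vimage: "reg_near a_regular (\<Phi> -` X) (\<Phi> -` Y) xb"
proof -
  obtain U where U: "open U" "\<Phi> xb \<in> U" "a_regular (X \<inter> U) (Y \<inter> U)"
    using a_reg unfolding reg_near_def by blast
  obtain \<kappa> r where \<kappa>: "\<kappa> > 0" "r > 0"
    "\<And>x v. x \<in> ball xb r \<Longrightarrow> v \<in> normal_cone (\<Phi> -` X) x \<Longrightarrow>
       \<exists>w\<in>normal_cone X (\<Phi> x). v = adjoint (blinfun_apply (\<Phi>' x)) w \<and> \<kappa> * norm w \<le> norm v"
    "\<And>x w. x \<in> ball xb r \<Longrightarrow> w \<in> normal_cone Y (\<Phi> x) \<Longrightarrow>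
       adjoint (blinfun_apply (\<Phi>' x)) w \<in> normal_cone (\<Phi> -` Y) x"
    using normal_cones_vimage by blast
  let ?W = "ball xb r \<inter> \<Phi> -` U"
  show ?thesis
  proof (rule reg_near_vimageI[OF U(1,2) \<kappa>(2)], unfold a_regular_def, intro allI impI, elim conjE)
    fix xs vs y v and \<phi> :: "nat \<Rightarrow> nat"
    assume xs: "\<forall>i::nat. xs i \<in> \<Phi> -` X \<inter> ?W" and y: "y \<in> \<Phi> -` Y \<inter> ?W" and lim: "xs \<longlonglongrightarrow> y"
      and vs: "\<forall>i. vs i \<in> normal_cone (\<Phi> -` X \<inter> ?W) (xs i)" and \<phi>: "strict_mono \<phi>" "(vs \<circ> \<phi>) \<longlonglongrightarrow> v"
    have "\<exists>w\<in>normal_cone X (\<Phi> (xs i)). vs i = adjoint (blinfun_apply (\<Phi>' (xs i))) w \<and> \<kappa> * norm w \<le> norm (vs i)" for i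
      by (rule \<kappa>(3)) (use xs vs normal_cone_vimage_Int[OF U(1)] in auto)
    then obtain ws where ws: "\<And>i. ws i \<in> normal_cone X (\<Phi> (xs i))"
       "\<And>i. vs i = adjoint (blinfun_apply (\<Phi>' (xs i))) (ws i)" "\<And>i. \<kappa> * norm (ws i) \<le> norm (vs i)"
      by metis
    obtain B where "\<And>i. norm ((vs \<circ> \<phi>) i) \<le> B"
      using convergent_imp_bounded[OF \<phi>(2)] by (auto simp: bounded_iff)
    then have "norm ((ws \<circ> \<phi>) i) \<le> B / \<kappa>" for i
      using ws(3)[of "\<phi> i"] \<kappa>(1) order_trans[OF ws(3)[of "\<phi> i"]] by (simp add: field_simps)
    then have "bounded (range (ws \<circ> \<phi>))" by (auto simp: bounded_iff)
    then obtain w \<psi> where w: "strict_mono \<psi>" "(ws \<circ> \<phi> \<circ> \<psi>) \<longlonglongrightarrow> w"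
      using bounded_imp_convergent_subsequence by blast
    have mono: "strict_mono (\<phi> \<circ> \<psi>)" using \<phi>(1) w(1) by (rule strict_mono_o)
    have wl: "(ws \<circ> (\<phi> \<circ> \<psi>)) \<longlonglongrightarrow> w" using w(2) by (simp add: o_assoc)
    have "(\<lambda>i. \<Phi> (xs i)) \<longlonglongrightarrow> \<Phi> y" by (rule isCont_tendsto_compose[OF isCont_map lim])
    then have "w \<in> normal_cone (Y \<inter> U) (\<Phi> y)"
      using U(3)[unfolded a_regular_def, rule_format, of "\<lambda>i. \<Phi> (xs i)" "\<Phi> y" ws "\<phi> \<circ> \<psi>" w]
        xs y ws(1) mono wl normal_cone_Int_open[OF U(1)] by auto
    then have "w \<in> normal_cone Y (\<Phi> y)" using normal_cone_Int_open[OF U(1)] y by auto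
    then have "adjoint (blinfun_apply (\<Phi>' y)) w \<in> normal_cone (\<Phi> -` Y) y" using \<kappa>(4) y by auto
    moreover have "adjoint (blinfun_apply (\<Phi>' y)) w = v"
    proof -
      have "(xs \<circ> (\<phi> \<circ> \<psi>)) \<longlonglongrightarrow> y" by (rule LIMSEQ_subseq_LIMSEQ[OF lim mono])
      then have "(\<lambda>n. \<Phi>' ((xs \<circ> (\<phi> \<circ> \<psi>)) n)) \<longlonglongrightarrow> \<Phi>' y"
        by (rule isCont_tendsto_compose[OF isCont_derivative])
      then have "(\<lambda>n. adjoint (blinfun_apply (\<Phi>' ((xs \<circ> (\<phi> \<circ> \<psi>)) n))) ((ws \<circ> (\<phi> \<circ> \<psi>)) n)) \<longlonglongrightarrow> adjoint (blinfun_apply (\<Phi>' y)) w"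
        by (rule tendsto_adjoint_blinfun) (rule wl)
      moreover have "(vs \<circ> \<phi> \<circ> \<psi>) \<longlonglongrightarrow> v" by (rule LIMSEQ_subseq_LIMSEQ[OF \<phi>(2) w(1)])
      ultimately show ?thesis
        using LIMSEQ_unique ws(2) by (simp add: o_def)
    qed
    ultimately show "v \<in> normal_cone (\<Phi> -` Y \<inter> ?W) y"
      using normal_cone_vimage_Int[OF U(1)] y by auto
  qed
qed

text \<open>Moving the adjoint across, \<open>v \<bullet> (y - x)\<close> becomes
  \<open>w \<bullet> (\<Phi> y - \<Phi> x)\<close> minus the pairing of \<open>w\<close> with the
  Taylor remainder. Scaling by \<open>\<kappa>\<close> brings \<open>w\<close> into the unit ball
  and is undone at the end.\<close>

lemma b_estimate:
  assumes v: "v = adjoint (blinfun_apply (\<Phi>' x)) w" "norm v \<le> 1" "\<kappa> > 0" "\<kappa> * norm w \<le> norm v"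
    and w: "rel_part d ((\<kappa> *\<^sub>R w) \<bullet> (\<Phi> y - \<Phi> x)) \<le> p"
    and R: "norm (\<Phi> y - \<Phi> x - \<Phi>' x (y - x)) \<le> q"
  shows "rel_part d (v \<bullet> (y - x)) \<le> (p + q) / \<kappa>"
proof -
  let ?R = "\<Phi> y - \<Phi> x - \<Phi>' x (y - x)"
  have "\<kappa> * (v \<bullet> (y - x)) = (\<kappa> *\<^sub>R w) \<bullet> (\<Phi> y - \<Phi> x) + - ((\<kappa> *\<^sub>R w) \<bullet> ?R)"
    by (simp add: v(1) inner_adjoint_blinfun inner_diff_right blinfun.diff_right algebra_simps)
  then have "\<kappa> * rel_part d (v \<bullet> (y - x)) \<le> rel_part d ((\<kappa> *\<^sub>R w) \<bullet> (\<Phi> y - \<Phi> x)) + \<bar>- ((\<kappa> *\<^sub>R w) \<bullet> ?R)\<bar>"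
    using rel_part_add rel_part_mult[of \<kappa>] v(3) by (metis less_imp_le)
  also have "\<bar>- ((\<kappa> *\<^sub>R w) \<bullet> ?R)\<bar> \<le> norm (\<kappa> *\<^sub>R w) * norm ?R"
    unfolding abs_minus_cancel by (rule Cauchy_Schwarz_ineq2)
  also have "\<dots> \<le> 1 * q"
    using v R by (intro mult_mono) auto
  finally show ?thesis using w v(3) by (simp add: field_simps)
qed

lemma b_regular_vimage:
  assumes "reg_near (b_regular d) X Y (\<Phi> xb)"
  shows "reg_near (b_regular d) (\<Phi> -` X) (\<Phi> -` Y) xb"
proof -
  obtain U where U: "open U" "\<Phi> xb \<in> U" "b_regular d (X \<inter> U) (Y \<inter> U)"
    using assms unfolding reg_near_def by blast
  obtain \<kappa> r where \<kappa>: "\<kappa> > 0" "r > 0"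
    "\<And>x v. x \<in> ball xb r \<Longrightarrow> v \<in> normal_cone (\<Phi> -` X) x \<Longrightarrow>
       \<exists>w\<in>normal_cone X (\<Phi> x). v = adjoint (blinfun_apply (\<Phi>' x)) w \<and> \<kappa> * norm w \<le> norm v"
    using normal_cones_vimage by metis
  let ?W = "ball xb r \<inter> \<Phi> -` U"
  obtain B where B: "B > 0" "\<And>x y. x \<in> cball xb r \<Longrightarrow> y \<in> cball xb r \<Longrightarrow> norm (\<Phi> x - \<Phi> y) \<le> B * norm (x - y)"
    using C1_lipschitz_on_cball[OF der cont] by blast
  have unif: "uniformly_continuous_on (cball xb r) \<Phi>'"
    by (intro compact_uniformly_continuous continuous_on_subset[OF cont]) auto
  show ?thesis
  proof (rule reg_near_vimageI[OF U(1,2) \<kappa>(2)], rule b_regularI)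
    fix \<epsilon> :: real assume \<epsilon>: "\<epsilon> > 0"
    \<comment> \<open>Two errors of size \<open>\<eta> * norm (y - x)\<close> arise, one from
      \<open>X\<close> and one from the remainder, and their sum is divided by
      \<open>\<kappa>\<close>. Distances grow under \<open>\<Phi>\<close> by at most
      \<open>B\<close>, hence \<open>\<eta> / B\<close> and \<open>\<delta>1 / B\<close>
      below.\<close>
    define \<eta> where "\<eta> = \<epsilon> * \<kappa> / 2"
    have \<eta>: "\<eta> > 0" using \<epsilon> \<kappa> by (simp add: \<eta>_def)
    obtain \<delta>1 where \<delta>1: "\<delta>1 > 0" "\<And>x y v. x \<in> X \<inter> U \<Longrightarrow> y \<in> Y \<inter> U \<Longrightarrow> v \<in> normal_cone (X \<inter> U) x \<inter> cball 0 1 \<Longrightarrow>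
       norm (y - x) < \<delta>1 \<Longrightarrow> rel_part d (v \<bullet> (y - x)) \<le> \<eta> / B * norm (y - x)"
      using b_regularD[OF U(3), of "\<eta> / B"] \<eta> B(1) by (metis divide_pos_pos)
    obtain \<delta>2 where \<delta>2: "\<delta>2 > 0" "\<And>x y. x \<in> cball xb r \<Longrightarrow> y \<in> cball xb r \<Longrightarrow> dist y x < \<delta>2 \<Longrightarrow> dist (\<Phi>' y) (\<Phi>' x) < \<eta>"
      using unif \<eta> unfolding uniformly_continuous_on_def by metis
    define \<delta> where "\<delta> = min (\<delta>1 / B) \<delta>2"
    have \<delta>: "\<delta> > 0" using \<delta>1 \<delta>2 B by (simp add: \<delta>_def)
    have "rel_part d (v \<bullet> (y - x)) \<le> \<epsilon> * norm (y - x)"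
      if x: "x \<in> \<Phi> -` X \<inter> ?W" and y: "y \<in> \<Phi> -` Y \<inter> ?W" and v: "v \<in> normal_cone (\<Phi> -` X \<inter> ?W) x \<inter> cball 0 1"
        and near: "norm (y - x) < \<delta>" for x y v
    proof -
      have xy: "x \<in> cball xb r" "y \<in> cball xb r" using x y by auto
      have "v \<in> normal_cone (\<Phi> -` X) x" using v x normal_cone_vimage_Int[OF U(1)] by auto
      then obtain w where w: "w \<in> normal_cone X (\<Phi> x)" "v = adjoint (blinfun_apply (\<Phi>' x)) w" "\<kappa> * norm w \<le> norm v"
        using \<kappa>(3) x by blast
      have lip: "norm (\<Phi> y - \<Phi> x) \<le> B * norm (y - x)" using B(2) xy by blast
      have "norm (y - x) < \<delta>1 / B" using near by (simp add: \<delta>_def)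
      then have "B * norm (y - x) < \<delta>1" using B(1) by (simp add: field_simps)
      with lip have "norm (\<Phi> y - \<Phi> x) < \<delta>1" by linarith
      moreover have "\<kappa> *\<^sub>R w \<in> normal_cone (X \<inter> U) (\<Phi> x) \<inter> cball 0 1"
        using normal_cone_scale[OF w(1), of \<kappa>] normal_cone_Int_open[OF U(1)] w(3) v \<kappa>(1) x by auto
      ultimately have "rel_part d ((\<kappa> *\<^sub>R w) \<bullet> (\<Phi> y - \<Phi> x)) \<le> \<eta> / B * norm (\<Phi> y - \<Phi> x)"
        using x y by (intro \<delta>1(2)) auto
      also have "\<dots> \<le> \<eta> / B * (B * norm (y - x))"
        using lip \<eta> B(1) by (intro mult_left_mono) auto
      also have "\<dots> = \<eta> * norm (y - x)" using B(1) by simp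
      finally have 1: "rel_part d ((\<kappa> *\<^sub>R w) \<bullet> (\<Phi> y - \<Phi> x)) \<le> \<eta> * norm (y - x)" .
      have 2: "norm (\<Phi> y - \<Phi> x - \<Phi>' x (y - x)) \<le> \<eta> * norm (y - x)"
      proof (rule C1_remainder_bound[OF der])
        fix z assume z: "z \<in> closed_segment x y"
        have "z \<in> cball xb r"
          using z xy closed_segment_subset[OF _ _ convex_cball] by blast
        moreover have "dist z x < \<delta>2"
          using dist_in_closed_segment[OF z] near by (auto simp: \<delta>_def dist_norm norm_minus_commute)
        ultimately show "norm (\<Phi>' z - \<Phi>' x) \<le> \<eta>"
          using \<delta>2(2) xy by (auto simp: dist_norm less_imp_le)
      qed
      have "rel_part d (v \<bullet> (y - x)) \<le> (\<eta> * norm (y - x) + \<eta> * norm (y - x)) / \<kappa>"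
        by (rule b_estimate[OF w(2) _ \<kappa>(1) w(3) 1 2]) (use v in auto)
      also have "\<dots> = \<epsilon> * norm (y - x)" using \<kappa>(1) by (simp add: \<eta>_def field_simps)
      finally show ?thesis .
    qed
    then show "\<exists>\<delta>>0. \<forall>x\<in>\<Phi> -` X \<inter> ?W. \<forall>y\<in>\<Phi> -` Y \<inter> ?W. \<forall>v\<in>normal_cone (\<Phi> -` X \<inter> ?W) x \<inter> cball 0 1.
        norm (y - x) < \<delta> \<longrightarrow> rel_part d (v \<bullet> (y - x)) \<le> \<epsilon> * norm (y - x)"
      using \<delta> by blast
  qed
qed

section \<open>Strong regularity under a locally Lipschitz derivative\<close>

context
  assumes lip: "\<And>r. \<exists>K\<ge>0. \<forall>x\<in>cball xb r. \<forall>y\<in>cball xb r. norm (\<Phi>' x - \<Phi>' y) \<le> K * norm (x - y)"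
begin

text \<open>The pullbacks of \<open>w\<close> at \<open>x\<close> and of its approximation
  \<open>u\<close> at \<open>y\<close> differ by a change of derivative and a change of multiplier,
  each linear in \<open>norm (x - y)\<close>.\<close>

lemma strongly_a_regular_vimage:
  assumes "reg_near strongly_a_regular X Y (\<Phi> xb)"
  shows "reg_near strongly_a_regular (\<Phi> -` X) (\<Phi> -` Y) xb"
proof -
  obtain U where U: "open U" "\<Phi> xb \<in> U" "strongly_a_regular (X \<inter> U) (Y \<inter> U)"
    using assms unfolding reg_near_def by blast
  obtain C where C: "C > 0" "\<And>x y v. x \<in> X \<inter> U \<Longrightarrow> y \<in> Y \<inter> U \<Longrightarrow> v \<in> normal_cone (X \<inter> U) x \<Longrightarrow>
       \<exists>w\<in>normal_cone (Y \<inter> U) y. norm (v - w) \<le> C * norm (x - y) * norm v"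
    using strongly_a_regularE[OF U(3)] by metis
  obtain \<kappa> r where \<kappa>: "\<kappa> > 0" "r > 0"
    "\<And>x v. x \<in> ball xb r \<Longrightarrow> v \<in> normal_cone (\<Phi> -` X) x \<Longrightarrow>
       \<exists>w\<in>normal_cone X (\<Phi> x). v = adjoint (blinfun_apply (\<Phi>' x)) w \<and> \<kappa> * norm w \<le> norm v"
    "\<And>x w. x \<in> ball xb r \<Longrightarrow> w \<in> normal_cone Y (\<Phi> x) \<Longrightarrow>
       adjoint (blinfun_apply (\<Phi>' x)) w \<in> normal_cone (\<Phi> -` Y) x"
    using normal_cones_vimage by blast
  let ?W = "ball xb r \<inter> \<Phi> -` U"
  obtain B where B: "B > 0" "\<And>x y. x \<in> cball xb r \<Longrightarrow> y \<in> cball xb r \<Longrightarrow> norm (\<Phi> x - \<Phi> y) \<le> B * norm (x - y)"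
    using C1_lipschitz_on_cball[OF der cont] by blast
  obtain K where K: "K \<ge> 0" "\<And>x y. x \<in> cball xb r \<Longrightarrow> y \<in> cball xb r \<Longrightarrow> norm (\<Phi>' x - \<Phi>' y) \<le> K * norm (x - y)"
    using lip[of r] by blast
  have "compact (\<Phi>' ` cball xb r)"
    by (intro compact_continuous_image continuous_on_subset[OF cont]) auto
  then obtain A where A: "A > 0" "\<And>x. x \<in> cball xb r \<Longrightarrow> norm (\<Phi>' x) \<le> A"
    using compact_imp_bounded bounded_pos by (metis imageI)
  \<comment> \<open>\<open>K\<close> accounts for the change of derivative; \<open>A * C * B\<close>
    combines the bound on the adjoint, the gap at the image points and their distance;
    \<open>1 / \<kappa>\<close> turns \<open>norm w\<close> into \<open>norm v\<close>.\<close>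
  define C' where "C' = (K + A * C * B) / \<kappa>"
  have C': "C' > 0" using K A C(1) B(1) \<kappa>(1) by (auto simp: C'_def intro!: divide_pos_pos add_nonneg_pos)
  show ?thesis
  proof (rule reg_near_vimageI[OF U(1,2) \<kappa>(2)], rule strongly_a_regularI[OF C'])
    fix x y v assume x: "x \<in> \<Phi> -` X \<inter> ?W" and y: "y \<in> \<Phi> -` Y \<inter> ?W" and v: "v \<in> normal_cone (\<Phi> -` X \<inter> ?W) x"
    have xy: "x \<in> cball xb r" "y \<in> cball xb r" using x y by auto
    have "v \<in> normal_cone (\<Phi> -` X) x" using v x normal_cone_vimage_Int[OF U(1)] by auto
    then obtain w where w: "w \<in> normal_cone X (\<Phi> x)" "v = adjoint (blinfun_apply (\<Phi>' x)) w" "\<kappa> * norm w \<le> norm v"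
      using \<kappa>(3) x by blast
    have "w \<in> normal_cone (X \<inter> U) (\<Phi> x)" using w(1) normal_cone_Int_open[OF U(1)] x by auto
    then obtain u where u: "u \<in> normal_cone (Y \<inter> U) (\<Phi> y)" "norm (w - u) \<le> C * norm (\<Phi> x - \<Phi> y) * norm w"
      using C(2)[of "\<Phi> x" "\<Phi> y" w] x y by auto
    have "u \<in> normal_cone Y (\<Phi> y)" using u(1) normal_cone_Int_open[OF U(1)] y by auto
    then have 1: "adjoint (blinfun_apply (\<Phi>' y)) u \<in> normal_cone (\<Phi> -` Y \<inter> ?W) y"
      using \<kappa>(4) y normal_cone_vimage_Int[OF U(1)] by auto
    have "v - adjoint (blinfun_apply (\<Phi>' y)) u =
       (adjoint (blinfun_apply (\<Phi>' x)) w - adjoint (blinfun_apply (\<Phi>' y)) w) + adjoint (blinfun_apply (\<Phi>' y)) (w - u)"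
      by (simp add: w(2) linear_diff[OF linear_adjoint_blinfun])
    also have "norm \<dots> \<le> norm (\<Phi>' x - \<Phi>' y) * norm w + norm (\<Phi>' y) * norm (w - u)"
      unfolding adjoint_blinfun_diff
      by (rule norm_triangle_mono) (rule norm_adjoint_blinfun_le)+
    also have "\<dots> \<le> K * norm (x - y) * norm w + A * (C * (B * norm (x - y)) * norm w)"
    proof (intro add_mono mult_mono)
      show "norm (w - u) \<le> C * (B * norm (x - y)) * norm w"
        by (rule order_trans[OF u(2)]) (intro mult_right_mono mult_left_mono B(2)[OF xy]; use C(1) in simp)
    qed (use K A xy in auto)
    also have "\<dots> = C' * norm (x - y) * (\<kappa> * norm w)" using \<kappa>(1) by (simp add: C'_def field_simps)
    also have "\<dots> \<le> C' * norm (x - y) * norm v" using w(3) C' by (intro mult_left_mono) auto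
    finally show "\<exists>u\<in>normal_cone (\<Phi> -` Y \<inter> ?W) y. norm (v - u) \<le> C' * norm (x - y) * norm v"
      using 1 by blast
  qed
qed

lemma strongly_b_regular_vimage:
  assumes "reg_near (strongly_b_regular d) X Y (\<Phi> xb)"
  shows "reg_near (strongly_b_regular d) (\<Phi> -` X) (\<Phi> -` Y) xb"
proof -
  obtain U where U: "open U" "\<Phi> xb \<in> U" "strongly_b_regular d (X \<inter> U) (Y \<inter> U)"
    using assms unfolding reg_near_def by blast
  obtain C where C: "C > 0" "\<And>x y v. x \<in> X \<inter> U \<Longrightarrow> y \<in> Y \<inter> U \<Longrightarrow> v \<in> normal_cone (X \<inter> U) x \<inter> cball 0 1 \<Longrightarrow>
       rel_part d (v \<bullet> (y - x)) \<le> C * (norm (x - y))\<^sup>2"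
    using U(3) unfolding strongly_b_regular_def rel_bound_iff by blast
  obtain \<kappa> r where \<kappa>: "\<kappa> > 0" "r > 0"
    "\<And>x v. x \<in> ball xb r \<Longrightarrow> v \<in> normal_cone (\<Phi> -` X) x \<Longrightarrow>
       \<exists>w\<in>normal_cone X (\<Phi> x). v = adjoint (blinfun_apply (\<Phi>' x)) w \<and> \<kappa> * norm w \<le> norm v"
    using normal_cones_vimage by metis
  let ?W = "ball xb r \<inter> \<Phi> -` U"
  obtain B where B: "B > 0" "\<And>x y. x \<in> cball xb r \<Longrightarrow> y \<in> cball xb r \<Longrightarrow> norm (\<Phi> x - \<Phi> y) \<le> B * norm (x - y)"
    using C1_lipschitz_on_cball[OF der cont] by blast
  obtain K where K: "K \<ge> 0" "\<And>x y. x \<in> cball xb r \<Longrightarrow> y \<in> cball xb r \<Longrightarrow> norm (\<Phi>' x - \<Phi>' y) \<le> K * norm (x - y)"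
    using lip[of r] by blast
  \<comment> \<open>\<open>C * B\<^sup>2\<close> comes from the quadratic estimate for
    \<open>X\<close> at the image points, \<open>K\<close> from the quadratic Taylor remainder,
    \<open>1 / \<kappa>\<close> from undoing the normalization.\<close>
  define C' where "C' = (C * B\<^sup>2 + K) / \<kappa>"
  have C': "C' > 0" using K C(1) B(1) \<kappa>(1) by (auto simp: C'_def intro!: divide_pos_pos add_pos_nonneg)
  show ?thesis
  proof (rule reg_near_vimageI[OF U(1,2) \<kappa>(2)], unfold strongly_b_regular_def rel_bound_iff,
      intro exI[of _ C'] conjI ballI C')
    fix x y v assume x: "x \<in> \<Phi> -` X \<inter> ?W" and y: "y \<in> \<Phi> -` Y \<inter> ?W"
      and v: "v \<in> normal_cone (\<Phi> -` X \<inter> ?W) x \<inter> cball 0 1"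
    have xy: "x \<in> cball xb r" "y \<in> cball xb r" using x y by auto
    have "v \<in> normal_cone (\<Phi> -` X) x" using v x normal_cone_vimage_Int[OF U(1)] by auto
    then obtain w where w: "w \<in> normal_cone X (\<Phi> x)" "v = adjoint (blinfun_apply (\<Phi>' x)) w" "\<kappa> * norm w \<le> norm v"
      using \<kappa>(3) x by blast
    have "\<kappa> *\<^sub>R w \<in> normal_cone (X \<inter> U) (\<Phi> x) \<inter> cball 0 1"
      using normal_cone_scale[OF w(1), of \<kappa>] normal_cone_Int_open[OF U(1)] w(3) v \<kappa>(1) x by auto
    then have "rel_part d ((\<kappa> *\<^sub>R w) \<bullet> (\<Phi> y - \<Phi> x)) \<le> C * (norm (\<Phi> x - \<Phi> y))\<^sup>2"
      using x y by (intro C(2)) auto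
    also have "\<dots> \<le> C * (B * norm (x - y))\<^sup>2"
      using B(2)[OF xy] C(1) by (intro mult_left_mono power_mono) auto
    finally have 1: "rel_part d ((\<kappa> *\<^sub>R w) \<bullet> (\<Phi> y - \<Phi> x)) \<le> C * (B * norm (x - y))\<^sup>2" .
    have 2: "norm (\<Phi> y - \<Phi> x - \<Phi>' x (y - x)) \<le> (K * norm (y - x)) * norm (y - x)"
    proof (rule C1_remainder_bound[OF der])
      fix z assume z: "z \<in> closed_segment x y"
      have "z \<in> cball xb r"
        using z xy closed_segment_subset[OF _ _ convex_cball] by blast
      then have "norm (\<Phi>' z - \<Phi>' x) \<le> K * norm (z - x)" using K(2) xy by blast
      also have "\<dots> \<le> K * norm (y - x)"
        using dist_in_closed_segment[OF z] K(1) by (intro mult_left_mono) (auto simp: dist_norm norm_minus_commute)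
      finally show "norm (\<Phi>' z - \<Phi>' x) \<le> K * norm (y - x)" .
    qed
    have "rel_part d (v \<bullet> (y - x)) \<le> (C * (B * norm (x - y))\<^sup>2 + (K * norm (y - x)) * norm (y - x)) / \<kappa>"
      by (rule b_estimate[OF w(2) _ \<kappa>(1) w(3) 1 2]) (use v in auto)
    also have "\<dots> = C' * (norm (x - y))\<^sup>2"
      using \<kappa>(1) by (simp add: C'_def field_simps power2_eq_square norm_minus_commute[of y x])
    finally show "rel_part d (v \<bullet> (y - x)) \<le> C' * (norm (x - y))\<^sup>2" .
  qed
qed

end

end

subsection \<open>Epigraphs and graphs\<close>

text \<open>Specifying the pullback by its inner products avoids computing adjoints of maps into or
  out of products.\<close>

lemma frechet_normal_cone_vimageI:
  fixes \<Phi> :: "'a::euclidean_space \<Rightarrow> 'b::euclidean_space"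
  assumes \<Phi>: "(\<Phi> has_derivative A) (at x)"
    and x: "x \<in> S" and w: "w \<in> frechet_normal_cone Y (\<Phi> x)"
    and ev: "\<forall>\<^sub>F y in at x within S. \<Phi> y \<in> Y"
    and v: "\<And>d. v \<bullet> d = w \<bullet> A d"
  shows "v \<in> frechet_normal_cone S x"
proof -
  have A: "blinfun_apply (Blinfun A) = A"
    using has_derivative_bounded_linear[OF \<Phi>] by (rule bounded_linear_Blinfun_apply)
  have "v = adjoint (blinfun_apply (Blinfun A)) w"
    by (rule vector_eq_rdot[THEN iffD1]) (simp add: A v inner_adjoint_blinfun[of "Blinfun A", unfolded A])
  then show ?thesis
    using adjoint_in_frechet_normal_cone[of \<Phi> "Blinfun A", OF _ x w ev] \<Phi> A by simp
qed

lemma C1_map_on_gradient: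
  fixes g :: "'a::euclidean_space \<Rightarrow> real"
  assumes "C1_map_on g U"
  obtains \<gamma> where "\<And>z. z \<in> U \<Longrightarrow> (g has_derivative (\<lambda>d. \<gamma> z \<bullet> d)) (at z)" "continuous_on U \<gamma>"
proof -
  obtain g' :: "'a \<Rightarrow> 'a \<Rightarrow>\<^sub>L real" where g': "\<And>z. z \<in> U \<Longrightarrow> (g has_derivative blinfun_apply (g' z)) (at z)"
     "continuous_on U g'"
    using assms unfolding C1_map_on_def by blast
  define \<gamma> where "\<gamma> z = adjoint (blinfun_apply (g' z)) 1" for z
  have "blinfun_apply (g' z) = (\<lambda>d. \<gamma> z \<bullet> d)" for z
    by (simp add: \<gamma>_def inner_adjoint_blinfun)
  moreover have "continuous_on U \<gamma>"
    using g'(2) unfolding continuous_on_def \<gamma>_def by (auto intro: tendsto_adjoint_blinfun)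
  ultimately show ?thesis using that g'(1) by metis
qed

context
  fixes h :: "'e::euclidean_space \<Rightarrow> ereal" and M U :: "'e set" and g :: "'e \<Rightarrow> real" and \<gamma> :: "'e \<Rightarrow> 'e"
  assumes U: "open U"
    and gradient: "\<And>z. z \<in> U \<Longrightarrow> (g has_derivative (\<lambda>d. \<gamma> z \<bullet> d)) (at z)"
    and cont_gradient: "continuous_on U \<gamma>"
    and h_eq: "\<And>z. z \<in> M \<inter> U \<Longrightarrow> h z = ereal (g z)"
begin

text \<open>\<open>y \<mapsto> (y, g y)\<close> parametrizes the graph over \<open>M\<close> near
  \<open>z\<close>; its adjoint derivative sends \<open>(v, s)\<close> to
  \<open>v + s *\<^sub>R \<gamma> z\<close>.\<close>

lemma frechet_normal_cone_gphD:
  assumes z: "z \<in> U" and vs: "(v, s) \<in> frechet_normal_cone (gph_on h M) (z, t)"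
  shows "v + s *\<^sub>R \<gamma> z \<in> frechet_normal_cone M z"
proof -
  have zM: "z \<in> M" "h z = ereal t" using vs by (auto simp: frechet_normal_cone_def gph_on_def)
  then have t: "t = g z" using h_eq z by simp
  have ev: "\<forall>\<^sub>F y in at z within M. y \<in> M \<and> y \<in> U"
    using eventually_at_in_open[OF U z] U z
    by (auto simp: eventually_at_filter intro: eventually_nhds_in_open elim: eventually_mono)
  show ?thesis
  proof (rule frechet_normal_cone_vimageI[where \<Phi> = "\<lambda>y. (y, g y)" and Y = "gph_on h M" and w = "(v, s)"])
    show "((\<lambda>y. (y, g y)) has_derivative (\<lambda>d. (d, \<gamma> z \<bullet> d))) (at z)"
      by (intro derivative_intros gradient z)
    show "\<forall>\<^sub>F y in at z within M. (y, g y) \<in> gph_on h M"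
      using ev by (rule eventually_mono) (auto simp: gph_on_def h_eq)
  qed (use zM vs t in \<open>auto simp: inner_add_left\<close>)
qed

lemma normal_cone_gphD:
  assumes z: "z \<in> U" and vs: "(v, s) \<in> normal_cone (gph_on h M) (z, t)"
  shows "v + s *\<^sub>R \<gamma> z \<in> normal_cone M z"
proof -
  obtain zs ws where *: "\<And>i::nat. ws i \<in> frechet_normal_cone (gph_on h M) (zs i)"
      "zs \<longlonglongrightarrow> (z, t)" "ws \<longlonglongrightarrow> (v, s)" "z \<in> M"
    using vs by (auto simp: normal_cone_def gph_on_def)
  have zl: "(\<lambda>i. fst (zs i)) \<longlonglongrightarrow> z" using tendsto_fst[OF *(2)] by simp
  have "isCont \<gamma> z" using cont_gradient U z by (simp add: continuous_on_eq_continuous_at)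
  then have "(\<lambda>i. \<gamma> (fst (zs i))) \<longlonglongrightarrow> \<gamma> z" using zl by (rule isCont_tendsto_compose)
  then have wl: "(\<lambda>i. fst (ws i) + snd (ws i) *\<^sub>R \<gamma> (fst (zs i))) \<longlonglongrightarrow> v + s *\<^sub>R \<gamma> z"
    using tendsto_fst[OF *(3)] tendsto_snd[OF *(3)] by (intro tendsto_intros) auto
  have "\<forall>\<^sub>F i in sequentially. fst (zs i) \<in> U"
    using zl U z by (rule topological_tendstoD)
  then have "\<forall>\<^sub>F i in sequentially. fst (ws i) + snd (ws i) *\<^sub>R \<gamma> (fst (zs i)) \<in> normal_cone M (fst (zs i))"
  proof eventually_elim
    case (elim i)
    show ?case
      by (rule subsetD[OF frechet_subset_normal_cone frechet_normal_cone_gphD[OF elim, of _ _ "snd (zs i)"]])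
         (use *(1) in simp)
  qed
  then show ?thesis by (rule normal_cone_closed_graph[OF *(4) zl wl])
qed

text \<open>Splits \<open>(v, s)\<close> into \<open>(v + s *\<^sub>R \<gamma> z, 0)\<close>, pulled
  back from \<open>M\<close> by the projection, and \<open>(- (s *\<^sub>R \<gamma> z), s)\<close>,
  pulled back from the point \<open>0\<close> by the defining equation
  \<open>r - g x = 0\<close>.\<close>

lemma frechet_normal_cone_gphI:
  assumes z: "z \<in> U" "(z, t) \<in> gph_on h M" and v: "v + s *\<^sub>R \<gamma> z \<in> frechet_normal_cone M z"
  shows "(v, s) \<in> frechet_normal_cone (gph_on h M) (z, t)"
proof -
  have t: "t = g z" using z h_eq by (auto simp: gph_on_def)
  have "(v + s *\<^sub>R \<gamma> z, 0) \<in> frechet_normal_cone (gph_on h M) (z, t)"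
    by (rule frechet_normal_cone_vimageI[where \<Phi> = fst and A = fst and Y = M])
       (use z v in \<open>auto simp: eventually_at_filter gph_on_def intro!: always_eventually bounded_linear_imp_has_derivative bounded_linear_fst\<close>)
  moreover have "(- (s *\<^sub>R \<gamma> z), s) \<in> frechet_normal_cone (gph_on h M) (z, t)"
  proof (rule frechet_normal_cone_vimageI[where \<Phi> = "\<lambda>p. snd p - g (fst p)" and Y = "{0}" and w = s])
    have "((\<lambda>p. g (fst p)) has_derivative (\<lambda>d. \<gamma> z \<bullet> fst d)) (at (z, t))"
      by (rule has_derivative_compose[where f = fst, OF bounded_linear_imp_has_derivative[OF bounded_linear_fst]])
         (use gradient z in auto)
    then show "((\<lambda>p. snd p - g (fst p)) has_derivative (\<lambda>d. snd d - \<gamma> z \<bullet> fst d)) (at (z, t))"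
      by (intro has_derivative_diff bounded_linear_imp_has_derivative bounded_linear_snd)
    have "\<forall>\<^sub>F p in at (z, t). p \<in> U \<times> UNIV"
      using U z by (intro eventually_at_in_open' open_Times) auto
    then have "\<forall>\<^sub>F p in at (z, t) within gph_on h M. p \<in> U \<times> UNIV"
      using eventually_at_filter by (auto simp: eventually_at_filter elim: eventually_mono)
    moreover have "\<forall>\<^sub>F p in at (z, t) within gph_on h M. p \<in> gph_on h M"
      by (simp add: eventually_at_filter)
    ultimately show "\<forall>\<^sub>F p in at (z, t) within gph_on h M. snd p - g (fst p) \<in> {0}"
      by eventually_elim (auto simp: gph_on_def h_eq)
  qed (use z t in \<open>auto simp: frechet_normal_cone_def eventually_at_filter inner_diff_right algebra_simps\<close>)
  ultimately have "(v + s *\<^sub>R \<gamma> z, 0) + (- (s *\<^sub>R \<gamma> z), s) \<in> frechet_normal_cone (gph_on h M) (z, t)"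
    by (rule frechet_normal_cone_add)
  then show ?thesis by simp
qed

end

section \<open>The map \<open>(x, r) \<mapsto> (c x, r)\<close> and the composition\<close>

text \<open>The identity block cancels in differences of derivatives, so continuity and Lipschitz
  bounds of \<open>c'\<close> transfer in operator norm.\<close>

lemma derivative_times_id:
  fixes c :: "'w::euclidean_space \<Rightarrow> 'e::euclidean_space"
  assumes der: "\<And>x. (c has_derivative blinfun_apply (c' x)) (at x)"
    and cont: "continuous_on UNIV c'"
  shows "\<exists>\<Phi>' :: 'w \<times> real \<Rightarrow> ('w \<times> real) \<Rightarrow>\<^sub>L ('e \<times> real).
    (\<forall>z. ((\<lambda>z. (c (fst z), snd z)) has_derivative blinfun_apply (\<Phi>' z)) (at z)) \<and>
    (\<forall>z d. blinfun_apply (\<Phi>' z) d = (blinfun_apply (c' (fst z)) (fst d), snd d)) \<and>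
    (\<forall>z z'. norm (\<Phi>' z - \<Phi>' z') \<le> norm (c' (fst z) - c' (fst z'))) \<and>
    continuous_on UNIV \<Phi>'"
proof -
  define \<Phi>' :: "'w \<times> real \<Rightarrow> ('w \<times> real) \<Rightarrow>\<^sub>L ('e \<times> real)"
    where "\<Phi>' z = Blinfun (\<lambda>d. (blinfun_apply (c' (fst z)) (fst d), snd d))" for z
  have "bounded_linear (\<lambda>d::'w \<times> real. (blinfun_apply (c' (fst z)) (fst d), snd d))" for z :: "'w \<times> real"
    by (intro bounded_linear_Pair bounded_linear_compose[OF blinfun.bounded_linear_right]
        bounded_linear_fst bounded_linear_snd)
  then have app: "blinfun_apply (\<Phi>' z) = (\<lambda>d. (blinfun_apply (c' (fst z)) (fst d), snd d))" for z
    unfolding \<Phi>'_def by (rule bounded_linear_Blinfun_apply)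
  have 1: "((\<lambda>z::'w \<times> real. (c (fst z), snd z)) has_derivative blinfun_apply (\<Phi>' z)) (at z)" for z
    unfolding app
    by (intro has_derivative_Pair bounded_linear_imp_has_derivative[OF bounded_linear_snd]
        has_derivative_compose[where f = fst, OF bounded_linear_imp_has_derivative[OF bounded_linear_fst]] der)
  have 2: "norm (\<Phi>' z - \<Phi>' z') \<le> norm (c' (fst z) - c' (fst z'))" for z z'
  proof (rule norm_blinfun_bound)
    fix d :: "'w \<times> real"
    have "norm (blinfun_apply (\<Phi>' z - \<Phi>' z') d) = norm (blinfun_apply (c' (fst z) - c' (fst z')) (fst d))"
      by (simp add: blinfun.diff_left app)
    also have "\<dots> \<le> norm (c' (fst z) - c' (fst z')) * norm (fst d)" by (rule norm_blinfun)
    also have "\<dots> \<le> norm (c' (fst z) - c' (fst z')) * norm d"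
      using norm_fst_le[of "fst d" "snd d"] by (intro mult_left_mono) auto
    finally show "norm (blinfun_apply (\<Phi>' z - \<Phi>' z') d) \<le> norm (c' (fst z) - c' (fst z')) * norm d" .
  qed simp
  have "continuous_on UNIV (\<lambda>z::'w \<times> real. c' (fst z))"
    by (rule continuous_on_compose2[OF cont]) (auto intro: continuous_intros)
  then have c: "((\<lambda>z::'w \<times> real. norm (c' (fst z) - c' (fst z0))) \<longlongrightarrow> 0) (at z0)" for z0 :: "'w \<times> real"
    by (intro tendsto_norm_zero LIM_zero) (unfold continuous_on_def, blast)
  have "(\<Phi>' \<longlongrightarrow> \<Phi>' z0) (at z0)" for z0
    by (rule LIM_zero_cancel, rule Lim_null_comparison[OF _ c]) (simp add: 2)
  then have "continuous_on UNIV \<Phi>'" by (simp add: continuous_on_def)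
  with 1 2 show ?thesis by (intro exI[of _ \<Phi>'] conjI allI) (simp_all only: app)
qed

lemma fun_reg_near_iff:
  assumes "M \<subseteq> eff_dom h" "x \<in> M"
  shows "fun_reg_near P h M x \<longleftrightarrow> reg_near P (epi h) (gph_on h M) (x, real_of_ereal (h x))"
  using assms by (simp add: fun_reg_near_def)

theorem theorem3p23:
  fixes c :: "'w::euclidean_space \<Rightarrow> 'e::euclidean_space"
    and h :: "'e \<Rightarrow> ereal"
    and M :: "'e set"
    and xb :: 'w
    and f :: "'w \<Rightarrow> ereal"
    and L :: "'w set"
  assumes c_C1: "C1_map_on c UNIV"
    and h_no_minf: "\<And>z. h z \<noteq> -\<infinity>"
    and h_closed: "closed (epi h)"
    and M_dom: "M \<subseteq> eff_dom h"
    and xb_M: "c xb \<in> M"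
    and M_C1: "manifold_around C1_map_on M (c xb)"
    and hM_C1: "restriction_smooth_near C1_map_on h M (c xb)"
    and transversal:
      "normal_cone M (c xb) \<inter> {v. adjoint (frechet_derivative c (at xb)) v = 0} = {0}"
    and f_eq: "f = (\<lambda>x. h (c x))"
    and L_eq: "L = c -` M"
  shows "(fun_reg_near a_regular h M (c xb) \<longrightarrow> fun_reg_near a_regular f L xb) \<and>
    (\<forall>d. fun_reg_near a_regular h M (c xb) \<and> fun_reg_near (b_regular d) h M (c xb)
       \<longrightarrow> fun_reg_near (b_regular d) f L xb) \<and>
    (C2_map_on c UNIV \<and> manifold_around C2_map_on M (c xb) \<and>
     restriction_smooth_near C2_map_on h M (c xb) \<longrightarrow>
       (fun_reg_near strongly_a_regular h M (c xb)
          \<longrightarrow> fun_reg_near strongly_a_regular f L xb) \<and>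
       (\<forall>d. fun_reg_near a_regular h M (c xb) \<and> fun_reg_near (strongly_b_regular d) h M (c xb)
          \<longrightarrow> fun_reg_near (strongly_b_regular d) f L xb))"
proof -
  define \<Phi> :: "'w \<times> real \<Rightarrow> 'e \<times> real" where "\<Phi> = (\<lambda>z. (c (fst z), snd z))"
  define X Y zb where "X = epi h" and "Y = gph_on h M" and "zb = (xb, real_of_ereal (h (c xb)))"
  have vimage: "epi f = \<Phi> -` X" "gph_on f L = \<Phi> -` Y"
    by (auto simp: \<Phi>_def X_def Y_def epi_def gph_on_def f_eq L_eq)
  have \<Phi>zb: "\<Phi> zb = (c xb, real_of_ereal (h (c xb)))" by (simp add: \<Phi>_def zb_def)
  have h_reg: "fun_reg_near P h M (c xb) \<longleftrightarrow> reg_near P X Y (\<Phi> zb)" for P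
    using fun_reg_near_iff[OF M_dom xb_M] by (simp add: \<Phi>zb X_def Y_def)
  have f_reg: "fun_reg_near P f L xb \<longleftrightarrow> reg_near P (\<Phi> -` X) (\<Phi> -` Y) zb" for P
  proof -
    have "L \<subseteq> eff_dom f" "xb \<in> L" using M_dom xb_M by (auto simp: L_eq f_eq eff_dom_def)
    then show ?thesis unfolding fun_reg_near_iff[OF \<open>L \<subseteq> eff_dom f\<close> \<open>xb \<in> L\<close>] vimage by (simp add: zb_def f_eq)
  qed
  obtain U g where U: "open U" "c xb \<in> U" and g: "C1_map_on g U" "\<forall>y\<in>M \<inter> U. h y = ereal (g y)"
    using hM_C1 unfolding restriction_smooth_near_def by blast
  obtain \<gamma> where \<gamma>: "\<And>z. z \<in> U \<Longrightarrow> (g has_derivative (\<lambda>d. \<gamma> z \<bullet> d)) (at z)" "continuous_on U \<gamma>"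
    using C1_map_on_gradient[OF g(1)] by blast
  note graph = normal_cone_gphD[OF U(1) \<gamma>(1,2) g(2)[rule_format]]
    frechet_normal_cone_gphI[OF U(1) \<gamma>(1,2) g(2)[rule_format]]
  obtain V where V: "open V" "c xb \<in> V" "\<And>y. y \<in> V \<Longrightarrow> normal_cone M y \<subseteq> frechet_normal_cone M y"
    using normal_cone_manifold[OF M_C1] by blast
  \<comment> \<open>A limiting graph normal gives a limiting normal of \<open>M\<close>; on the
    manifold this is a Frechet normal, which lifts back to a Frechet normal of the graph.\<close>
  have normal_Y: "\<exists>W. open W \<and> \<Phi> zb \<in> W \<and> (\<forall>y\<in>W. normal_cone Y y \<subseteq> frechet_normal_cone Y y)"
  proof (intro exI[of _ "(U \<inter> V) \<times> UNIV"] conjI ballI)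
    show "open ((U \<inter> V) \<times> (UNIV :: real set))" using U V by (intro open_Times open_Int) auto
    fix p assume p: "p \<in> (U \<inter> V) \<times> (UNIV :: real set)"
    obtain z t where zt: "p = (z, t)" "z \<in> U" "z \<in> V" using p by auto
    show "normal_cone Y p \<subseteq> frechet_normal_cone Y p"
    proof
      fix w assume w: "w \<in> normal_cone Y p"
      have "(fst w, snd w) \<in> frechet_normal_cone (gph_on h M) (z, t)"
      proof (rule graph(2))
        show "(z, t) \<in> gph_on h M" using w by (simp add: zt normal_cone_def Y_def)
        show "fst w + snd w *\<^sub>R \<gamma> z \<in> frechet_normal_cone M z"
          using graph(1)[where z = z and v = "fst w" and s = "snd w" and t = t] w V(3) zt by (auto simp: Y_def)
      qed (use zt in auto)
      then show "w \<in> frechet_normal_cone Y p" by (simp add: zt Y_def)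
    qed
  qed (use U V \<Phi>zb in auto)
  \<comment> \<open>The derivative \<open>c'\<close> is kept arbitrary so that the same claim also
    serves the one supplied by the second-order smoothness of \<open>c\<close>.\<close>
  have preimage: "\<exists>\<Phi>'. transversal_preimage \<Phi> \<Phi>' X Y zb \<and>
      (\<forall>z z'. norm (\<Phi>' z - \<Phi>' z') \<le> norm (c' (fst z) - c' (fst z')))"
    if c': "\<And>x. (c has_derivative blinfun_apply (c' x)) (at x)" "continuous_on UNIV c'"
      and a: "reg_near a_regular X Y (\<Phi> zb)" for c' :: "'w \<Rightarrow> 'w \<Rightarrow>\<^sub>L 'e"
  proof -
    obtain \<Phi>' where
      "(\<forall>z. (\<Phi> has_derivative blinfun_apply (\<Phi>' z)) (at z)) \<and>
       (\<forall>z d. blinfun_apply (\<Phi>' z) d = (blinfun_apply (c' (fst z)) (fst d), snd d)) \<and>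
       (\<forall>z z'. norm (\<Phi>' z - \<Phi>' z') \<le> norm (c' (fst z) - c' (fst z'))) \<and>
       continuous_on UNIV \<Phi>'"
      using derivative_times_id[OF c', folded \<Phi>_def] ..
    then have \<Phi>': "\<And>z. (\<Phi> has_derivative blinfun_apply (\<Phi>' z)) (at z)"
      "\<And>z d. blinfun_apply (\<Phi>' z) d = (blinfun_apply (c' (fst z)) (fst d), snd d)"
      "\<And>z z'. norm (\<Phi>' z - \<Phi>' z') \<le> norm (c' (fst z) - c' (fst z'))"
      "continuous_on UNIV \<Phi>'"
      by blast+
    have "w = 0" if w: "w \<in> normal_cone Y (\<Phi> zb)" "adjoint (blinfun_apply (\<Phi>' zb)) w = 0" for w
    proof -
      have zero: "w \<bullet> blinfun_apply (\<Phi>' zb) d = 0" for d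
        using w(2) inner_adjoint_blinfun[of "\<Phi>' zb" w d] by simp
      \<comment> \<open>The vertical direction isolates the last coordinate; horizontal directions
        then place \<open>fst w\<close> in the kernel of the adjoint derivative of
        \<open>c\<close>.\<close>
      have s: "snd w = 0"
        using zero[of "(0, 1)"] by (simp add: \<Phi>'(2) inner_prod_def)
      have "adjoint (blinfun_apply (c' xb)) (fst w) \<bullet> d = 0 \<bullet> d" for d
        using zero[of "(d, 0)"] by (simp add: \<Phi>'(2) inner_prod_def inner_adjoint_blinfun zb_def)
      then have "adjoint (blinfun_apply (c' xb)) (fst w) = 0"
        using vector_eq_rdot by blast
      then have "adjoint (frechet_derivative c (at xb)) (fst w) = 0"
        using frechet_derivative_at[OF c'(1)] by simp
      moreover have "fst w + snd w *\<^sub>R \<gamma> (c xb) \<in> normal_cone M (c xb)"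
        by (rule graph(1)[where t = "real_of_ereal (h (c xb))"])
           (use w(1) U(2) in \<open>simp_all add: Y_def \<Phi>zb\<close>)
      then have "fst w \<in> normal_cone M (c xb)" using s by simp
      ultimately have "fst w = 0" using transversal by blast
      with s show ?thesis by (simp add: prod_eq_iff)
    qed
    then have "transversal_preimage \<Phi> \<Phi>' X Y zb"
      using \<Phi>' h_closed a normal_Y by unfold_locales (auto simp: X_def)
    with \<Phi>'(3) show ?thesis by blast
  qed
  obtain c' :: "'w \<Rightarrow> 'w \<Rightarrow>\<^sub>L 'e" where c': "\<And>x. (c has_derivative blinfun_apply (c' x)) (at x)" "continuous_on UNIV c'"
    using c_C1 unfolding C1_map_on_def by blast
  have 1: "fun_reg_near a_regular h M (c xb) \<longrightarrow> fun_reg_near a_regular f L xb"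
    using preimage[OF c'] transversal_preimage.a_regular_vimage unfolding h_reg f_reg by blast
  have 2: "fun_reg_near a_regular h M (c xb) \<and> fun_reg_near (b_regular d) h M (c xb)
       \<longrightarrow> fun_reg_near (b_regular d) f L xb" for d
    using preimage[OF c'] transversal_preimage.b_regular_vimage unfolding h_reg f_reg by blast
  have C2: "\<exists>\<Phi>'. transversal_preimage \<Phi> \<Phi>' X Y zb \<and>
      (\<forall>r. \<exists>K\<ge>0. \<forall>x\<in>cball zb r. \<forall>y\<in>cball zb r. norm (\<Phi>' x - \<Phi>' y) \<le> K * norm (x - y))"
    if "C2_map_on c UNIV" and a: "reg_near a_regular X Y (\<Phi> zb)"
  proof -
    obtain c' :: "'w \<Rightarrow> 'w \<Rightarrow>\<^sub>L 'e" where c': "\<And>x. (c has_derivative blinfun_apply (c' x)) (at x)" "C1_map_on c' UNIV"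
      using \<open>C2_map_on c UNIV\<close> unfolding C2_map_on_def by blast
    obtain c'' where c'': "\<And>x. (c' has_derivative blinfun_apply (c'' x)) (at x)" "continuous_on UNIV c''"
      using c'(2) unfolding C1_map_on_def by blast
    have "continuous_on UNIV c'"
      using c''(1) by (meson continuous_at_imp_continuous_on has_derivative_continuous)
    then obtain \<Phi>' where \<Phi>': "transversal_preimage \<Phi> \<Phi>' X Y zb"
        "\<And>z z'. norm (\<Phi>' z - \<Phi>' z') \<le> norm (c' (fst z) - c' (fst z'))"
      using preimage[OF c'(1) _ a] by blast
    have "\<exists>K\<ge>0. \<forall>x\<in>cball zb r. \<forall>y\<in>cball zb r. norm (\<Phi>' x - \<Phi>' y) \<le> K * norm (x - y)" for r
    proof -
      obtain B where B: "B > 0" "\<And>x y. x \<in> cball xb r \<Longrightarrow> y \<in> cball xb r \<Longrightarrow> norm (c' x - c' y) \<le> B * norm (x - y)"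
        using C1_lipschitz_on_cball[OF c''] by blast
      have "norm (\<Phi>' x - \<Phi>' y) \<le> B * norm (x - y)" if "x \<in> cball zb r" "y \<in> cball zb r" for x y
      proof -
        have "norm (\<Phi>' x - \<Phi>' y) \<le> norm (c' (fst x) - c' (fst y))" by (rule \<Phi>'(2))
        also have "\<dots> \<le> B * norm (fst x - fst y)"
          using that dist_fst_le[of zb x] dist_fst_le[of zb y] by (intro B(2)) (auto simp: zb_def)
        also have "\<dots> \<le> B * norm (x - y)"
          using dist_fst_le[of x y] B(1) by (simp add: dist_norm)
        finally show ?thesis .
      qed
      then show ?thesis using B(1) less_imp_le by blast
    qed
    with \<Phi>'(1) show ?thesis by blast
  qed
  have strong: "reg_near a_regular X Y (\<Phi> zb)" if "reg_near strongly_a_regular X Y (\<Phi> zb)"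
    using that strongly_a_regular_imp_a_regular unfolding reg_near_def by blast
  have 3: "fun_reg_near strongly_a_regular h M (c xb) \<longrightarrow> fun_reg_near strongly_a_regular f L xb"
    if "C2_map_on c UNIV"
    using C2[OF that strong] transversal_preimage.strongly_a_regular_vimage
    unfolding h_reg f_reg by blast
  have 4: "fun_reg_near a_regular h M (c xb) \<and> fun_reg_near (strongly_b_regular d) h M (c xb)
          \<longrightarrow> fun_reg_near (strongly_b_regular d) f L xb"
    if "C2_map_on c UNIV" for d
    using C2[OF that] transversal_preimage.strongly_b_regular_vimage
    unfolding h_reg f_reg by blast
  show ?thesis using 1 2 3 4 by blast
qed

end
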